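(* Let $n\ge 2$ and let $\mathcal{P}$ be the regular $2n$-gon described in the context, with alternating wired/free boundary conditions. Its response matrix $\Lambda$ has entries $$\Lambda_{j,k} = \frac{\cot\left[\frac{\pi}{n}\left(j-k+\frac12\right)\right] - \cot\left[\frac{\pi}{n}\left(j-k-\frac12\right)\right]}{n},\qquad 1\le j,k\le n.$$
   Context: Let $n\ge 2$ be an integer and let $\mathcal{P}\subset\mathbb{C}$ be the closed regular polygon with $2n$ sides, centered at the origin, such that the midpoint of its $j$-th side lies at $e^{i\pi j/n}$ for $1\le j\le 2n$. The even-numbered sides are called nodes: node $j$ ($1\le j\le n$) is side $2j$. The odd-numbered sides are called free edges. Given constants $v_1,\dots,v_n$, let $V$ be the unique continuous function on $\mathcal{P}$ that is harmonic in the interior, equals $v_j$ on side $2j$, and has zero normal derivative on the free edges. The current $I_j$ entering $\mathcal{P}$ through node $j$ is the flux of $-\nabla V$ through side $2j$ into $\mathcal{P}$. The response matrix (Dirichlet-to-Neumann map) $\Lambda$ is the $n\times n$ matrix with $\vec I=\Lambda\vec v$, where $\vec v=(v_1,\dots,v_n)$ and $\vec I=(I_1,\dots,I_n)$; equivalently, $\Lambda_{j,k}$ is the current entering through node $j$ when node $k$ is held at voltage $1$ and all other nodes at $0$. *)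

theory Defs
  imports "HOL-Analysis.Analysis"
begin

text \<open>Geometry of the regular 2n-gon: the midpoint of side m (1 <= m <= 2n) is
  cis(pi m / n); its vertices lie at radius 1/cos(pi/(2n)) and angles
  pi (m -+ 1/2)/n.  The outward unit normal of side m is cis(pi m / n).\<close>

definition vtx :: "nat \<Rightarrow> real \<Rightarrow> complex" where
  "vtx n t = complex_of_real (1 / cos (pi / (2 * real n))) * cis (pi * t / real n)"

definition side_a :: "nat \<Rightarrow> nat \<Rightarrow> complex" where
  "side_a n m = vtx n (real m - 1/2)"

definition side_b :: "nat \<Rightarrow> nat \<Rightarrow> complex" where
  "side_b n m = vtx n (real m + 1/2)"

definition out_normal :: "nat \<Rightarrow> nat \<Rightarrow> complex" where
  "out_normal n m = cis (pi * real m / real n)"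

definition polygon :: "nat \<Rightarrow> complex set" where
  "polygon n = convex hull (side_a n ` {1..2*n})"

definition harmonic_on :: "complex set \<Rightarrow> (complex \<Rightarrow> real) \<Rightarrow> bool" where
  "harmonic_on S V \<longleftrightarrow> open S \<and>
     (\<exists>Vx Vy Vxx Vxy Vyx Vyy.
        continuous_on S Vx \<and> continuous_on S Vy \<and>
        continuous_on S Vxx \<and> continuous_on S Vxy \<and>
        continuous_on S Vyx \<and> continuous_on S Vyy \<and>
        (\<forall>z\<in>S.
          ((\<lambda>t. V (z + complex_of_real t)) has_real_derivative Vx z) (at 0) \<and>
          ((\<lambda>t. V (z + \<i> * complex_of_real t)) has_real_derivative Vy z) (at 0) \<and>
          ((\<lambda>t. Vx (z + complex_of_real t)) has_real_derivative Vxx z) (at 0) \<and>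
          ((\<lambda>t. Vx (z + \<i> * complex_of_real t)) has_real_derivative Vxy z) (at 0) \<and>
          ((\<lambda>t. Vy (z + complex_of_real t)) has_real_derivative Vyx z) (at 0) \<and>
          ((\<lambda>t. Vy (z + \<i> * complex_of_real t)) has_real_derivative Vyy z) (at 0) \<and>
          Vxx z + Vyy z = 0))"

definition outward_nd :: "(complex \<Rightarrow> real) \<Rightarrow> complex \<Rightarrow> complex \<Rightarrow> real \<Rightarrow> bool" where
  "outward_nd V nu z d \<longleftrightarrow>
     ((\<lambda>t. V (z - complex_of_real t * nu)) has_real_derivative (- d)) (at_right 0)"

definition bvp :: "nat \<Rightarrow> (nat \<Rightarrow> real) \<Rightarrow> (complex \<Rightarrow> real) \<Rightarrow> bool" where
  "bvp n v V \<longleftrightarrow>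
     continuous_on (polygon n) V \<and>
     harmonic_on (interior (polygon n)) V \<and>
     (\<forall>j\<in>{1..n}. \<forall>z\<in>closed_segment (side_a n (2*j)) (side_b n (2*j)). V z = v j) \<and>
     (\<forall>j\<in>{1..n}. \<forall>z\<in>open_segment (side_a n (2*j-1)) (side_b n (2*j-1)).
        outward_nd V (out_normal n (2*j-1)) z 0)"

text \<open>The current I entering through node j: flux of -grad V through side 2j into
  the polygon, i.e. the arc-length integral of the outward normal derivative of V
  over side 2j (an improper/Henstock-Kurzweil integral).\<close>

definition node_current :: "nat \<Rightarrow> (complex \<Rightarrow> real) \<Rightarrow> nat \<Rightarrow> real \<Rightarrow> bool" where
  "node_current n V j I \<longleftrightarrow>
     (let a = side_a n (2*j); b = side_b n (2*j) in
       \<exists>d. (\<forall>z\<in>open_segment a b. outward_nd V (out_normal n (2*j)) z (d z)) \<and>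
           ((\<lambda>s. norm (b - a) * d (linepath a b s)) has_integral I) {0..1})"

end

theory Submission
  imports Defs "HOL-Complex_Analysis.Complex_Analysis"
begin

text \<open>The Schwarz--Christoffel map with derivative proportional to \<open>(1 + w\<^bsup>2n\<^esup>)\<^bsup>-1/n\<^esup>\<close> carries the closed
  disc onto the polygon, and the solution is pulled back to the disc as the real part of a combination
  of the primitives of \<open>w\<^bsup>m-1\<^esup> (1 + w\<^bsup>2n\<^esup>)\<^bsup>-1/2\<^esup>\<close> with \<open>1 \<le> m < n\<close>. The primitive with index \<open>m\<close> is multiplied by
  \<open>exp (\<pi> \<i> m / n)\<close> under rotation by one side, so its values at the vertices are
  explicit up to a real factor; the factors for \<open>m\<close> and \<open>n - m\<close> have an elementary ratio. Normalising
  by them turns voltages and currents into differences of geometric sums of roots of unity,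
  which give the Kronecker delta and the cotangents. Both map and primitives are given
  as integrals along rays from the origin, so that domination by \<open>(1 - t)\<^bsup>-1/2\<^esup>\<close> yields continuity up
  to the closed disc.\<close>

section \<open>Geometry of the polygon\<close>

text \<open>Why these primitives: write the potential as Re F with F holomorphic in the disc. On a
  node arc Re F is constant, so w F'(w) is real there; on a free arc the radial derivative of Re F
  vanishes, so w F'(w) is imaginary. Its phase must make a quarter turn at each root of w^(2n) = -1,
  which the factor (1 + w^(2n))^(-1/2) achieves. The powers w^m with 0 < m < n, with conjugate
  coefficients at m and n - m, leave n - 1 real parameters: one per node, modulo constants. The
  current through a node is the increment of Im F between its two ends, so no flux has to be
  evaluated. The obstacle is regularity. \<open>bvp\<close> offers continuity on the closed polygon
  and pointwise normal derivatives on the free edges, too little for an energy argument by Green's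
  identity. Uniqueness therefore comes from a maximum principle with an explicit barrier, and the
  normal derivatives on the nodes are found for one explicit solution and transferred to all others.
  The vertices are branch points, so statements along an arc or a side pair differentiability inside
  with mere continuity at the ends.\<close>

lemma cos_sector_le:
  fixes k :: int and n :: nat
  assumes "n > 0" "\<bar>\<phi>\<bar> \<le> pi / (2 * real n)"
  shows "cos (pi * real_of_int k / real n + \<phi>) \<le> cos \<phi>"
proof -
  define r where "r = k mod (2 * int n)"
  have r: "0 \<le> r" "r < 2 * int n" using assms by (auto simp: r_def)
  have k: "k = r + 2 * int n * (k div (2 * int n))" by (simp add: r_def)
  have "pi * real_of_int k / real n + \<phi> = (pi * real_of_int r / real n + \<phi>) + 2 * pi * real_of_int (k div (2 * int n))"
    using assms(1) by (subst k) (simp add: field_simps)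
  then have "cos (pi * real_of_int k / real n + \<phi>) = cos ((pi * real_of_int r / real n + \<phi>) + 2 * pi * real_of_int (k div (2 * int n)))"
    by (simp only:)
  also have "\<dots> = cos (pi * real_of_int r / real n + \<phi>)"
    by (subst cos_add) (simp add: sin_int_2pin cos_int_2pin)
  finally have eq: "cos (pi * real_of_int k / real n + \<phi>) = cos (pi * real_of_int r / real n + \<phi>)" .
  \<comment> \<open>For r nonzero the half angle x stays pi/(2n) away from 0 and pi, so x + phi is
    still in [0, pi], and the sum-to-product formula gives a product of nonnegative sines.\<close>
  have "0 \<le> cos \<phi> - cos (pi * real_of_int r / real n + \<phi>)"
  proof (cases "r = 0")
    case False
    then have r1: "1 \<le> real_of_int r" "real_of_int r \<le> 2 * real n - 1" using r by linarith+
    define x where "x = pi * real_of_int r / (2 * real n)"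
    have x: "pi / (2 * real n) \<le> x" "x \<le> pi - pi / (2 * real n)"
      using mult_left_mono[OF r1(1), of pi] mult_left_mono[OF r1(2), of pi] assms(1)
      by (simp_all add: x_def field_simps)
    have p: "pi / (2 * real n) > 0" using assms by simp
    have "cos \<phi> - cos (2 * x + \<phi>) = 2 * sin (x + \<phi>) * sin x"
    proof -
      have "(\<phi> + (2 * x + \<phi>)) / 2 = x + \<phi>" "((2 * x + \<phi>) - \<phi>) / 2 = x" by simp_all
      then show ?thesis by (simp only: cos_diff_cos)
    qed
    moreover have "sin x \<ge> 0" "sin (x + \<phi>) \<ge> 0"
      using x p assms(2) by (auto intro!: sin_ge_zero)
    moreover have "2 * x = pi * real_of_int r / real n" by (simp add: x_def)
    ultimately show ?thesis by simp
  qed simp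
  then show ?thesis using eq by simp
qed

lemma polar_sector:
  assumes "n > 0"
  obtains m \<phi> where "m \<in> {1..2*n}" "\<bar>\<phi>\<bar> \<le> pi / (2 * real n)"
    "z = complex_of_real (cmod z) * (out_normal n m * cis \<phi>)"
proof -
  define k where "k = round (Arg z * real n / pi)"
  \<comment> \<open>Sides are numbered 1 to 2n, not 0 to 2n - 1; hence the shift by one around the
    reduction modulo 2n.\<close>
  define m where "m = nat ((k - 1) mod (2 * int n)) + 1"
  define \<phi> where "\<phi> = Arg z - pi * real_of_int k / real n"
  define d where "d = (k - 1) div (2 * int n)"
  have m: "m \<in> {1..2*n}"
    using assms pos_mod_bound[of "2 * int n" "k - 1"] by (auto simp: m_def Suc_le_eq nat_less_iff)
  have "int m = (k - 1) mod (2 * int n) + 1" using assms by (simp add: m_def)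
  then have "int m + 2 * int n * d = k" by (simp add: d_def)
  then have "real_of_int k = real_of_int (int m + 2 * int n * d)" by simp
  then have km: "real_of_int k = real m + 2 * real n * real_of_int d" by simp
  have "pi * real_of_int k / real n = pi * real m / real n + 2 * pi * real_of_int d"
    using assms by (simp add: km field_simps)
  then have nu: "cis (pi * real_of_int k / real n) = out_normal n m"
    by (simp add: out_normal_def flip: cis_mult)
  have "\<bar>real_of_int k - Arg z * real n / pi\<bar> \<le> 1/2"
    unfolding k_def by (rule of_int_round_abs_le)
  moreover have "\<phi> = - ((real_of_int k - Arg z * real n / pi) * (pi / real n))"
    using assms by (simp add: \<phi>_def field_simps)
  ultimately have "\<bar>\<phi>\<bar> \<le> 1/2 * (pi / real n)"
    using assms by (simp only: abs_minus_cancel abs_mult) (intro mult_mono, auto)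
  then have "\<bar>\<phi>\<bar> \<le> pi / (2 * real n)" using assms by (simp add: field_simps)
  moreover have "z = complex_of_real (cmod z) * (out_normal n m * cis \<phi>)"
  proof -
    have "out_normal n m * cis \<phi> = cis (Arg z)"
      by (simp add: nu[symmetric] cis_mult \<phi>_def)
    then show ?thesis using rcis_cmod_Arg[of z] by (simp add: rcis_def)
  qed
  ultimately show ?thesis using m that by blast
qed

text \<open>Arc-length coordinate on the line carrying side \<open>l\<close>: \<open>y\<close> is
  the signed distance from the midpoint, and also the tangent of the angle seen from the centre. The
  side itself is |y| <= tan (pi/(2n)).\<close>

definition side_pt :: "nat \<Rightarrow> nat \<Rightarrow> real \<Rightarrow> complex" where
  "side_pt n l y = out_normal n l * Complex 1 y"

lemma cnj_out_normal [simp]: "cnj (out_normal n l) * out_normal n l = 1"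
  "out_normal n l * cnj (out_normal n l) = 1"
  "cnj (out_normal n l) * (out_normal n l * z) = z"
  by (simp_all add: out_normal_def cis_cnj cis_mult flip: mult.assoc)

lemma norm_out_normal [simp]: "cmod (out_normal n l) = 1" "out_normal n l \<noteq> 0"
  by (auto simp: out_normal_def)

context
  fixes n :: nat
  assumes n2: "n \<ge> 2"
begin

lemma half_angle: "0 < pi / (2 * real n)" "pi / (2 * real n) \<le> pi / 4" "pi / (2 * real n) < pi / 2"
  using n2 by (auto simp: field_simps)

lemma cos_half_angle_pos: "0 < cos (pi / (2 * real n))"
  using half_angle by (intro cos_gt_zero) auto

lemma cos_sector_pos: "\<bar>\<phi>\<bar> \<le> pi / (2 * real n) \<Longrightarrow> 0 < cos \<phi>"
  using half_angle by (intro cos_gt_zero_pi) auto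

lemma tan_half_angle: "0 < tan (pi / (2 * real n))" "tan (pi / (2 * real n)) \<le> 1"
proof -
  show "0 < tan (pi / (2 * real n))" using half_angle by (intro tan_gt_zero) auto
  have "tan (pi / (2 * real n)) \<le> tan (pi / 4)"
    using half_angle by (subst tan_mono_le_eq) auto
  then show "tan (pi / (2 * real n)) \<le> 1" by (simp add: tan_45)
qed

lemma cis_div_cos: "cos \<phi> \<noteq> 0 \<Longrightarrow> cis \<phi> = complex_of_real (cos \<phi>) * Complex 1 (tan \<phi>)"
  by (simp add: complex_eq_iff tan_def)

lemma side_ends:
  "side_a n l = side_pt n l (- tan (pi / (2 * real n)))"
  "side_b n l = side_pt n l (tan (pi / (2 * real n)))"
proof -
  define a where "a = pi / (2 * real n)"
  have c: "cos a > 0" using cos_half_angle_pos by (simp add: a_def)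
  have "pi * (real l - 1/2) / real n = pi * real l / real n + (-a)"
       "pi * (real l + 1/2) / real n = pi * real l / real n + a"
    using n2 by (auto simp: a_def field_simps)
  then have "side_a n l = complex_of_real (1 / cos a) * (out_normal n l * cis (-a))"
    "side_b n l = complex_of_real (1 / cos a) * (out_normal n l * cis a)"
    unfolding side_a_def side_b_def vtx_def out_normal_def by (simp_all only: cis_mult a_def)
  then show "side_a n l = side_pt n l (- tan (pi / (2 * real n)))"
      "side_b n l = side_pt n l (tan (pi / (2 * real n)))"
    using c cis_div_cos[of a] cis_div_cos[of "-a"] by (simp_all add: side_pt_def a_def)
qed

lemma side_pt_diff: "side_pt n l y - side_pt n l x = out_normal n l * (\<i> * complex_of_real (y - x))"
  by (simp add: side_pt_def flip: right_diff_distrib) (simp add: complex_eq_iff)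

lemma side_pt_inj: "side_pt n l y = side_pt n l x \<longleftrightarrow> x = y"
  by (auto simp: side_pt_def)

lemma linepath_side:
  "linepath (side_pt n l x) (side_pt n l y) u = side_pt n l ((1-u)*x + u*y)"
  by (simp add: side_pt_def linepath_def scaleR_conv_of_real algebra_simps)
     (simp add: complex_eq_iff algebra_simps)

lemma closed_side:
  "closed_segment (side_a n l) (side_b n l) = side_pt n l ` {- tan (pi / (2 * real n)) .. tan (pi / (2 * real n))}"
proof -
  define T where "T = tan (pi / (2 * real n))"
  have "closed_segment (side_pt n l (-T)) (side_pt n l T) = side_pt n l ` closed_segment (-T) T"
    unfolding linepath_image_01[symmetric] image_image linepath_side by (simp add: linepath_def)
  then show ?thesis using tan_half_angle by (simp add: side_ends T_def closed_segment_eq_real_ivl)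
qed

lemma open_side:
  "open_segment (side_a n l) (side_b n l) = side_pt n l ` {- tan (pi / (2 * real n)) <..< tan (pi / (2 * real n))}"
  unfolding open_segment_def closed_side by (auto simp: side_ends side_pt_inj image_iff)

lemma Re_side_pt: "Re (cnj (out_normal n l) * side_pt n l y) = 1"
  by (simp add: side_pt_def)

text \<open>In the angular sector of side \<open>m\<close>, the half-plane of side \<open>m\<close>
  is the most restrictive one. This reduces membership in the polygon to a single inequality per
  sector.\<close>

lemma Re_normal_sector:
  assumes "\<bar>\<phi>\<bar> \<le> pi / (2 * real n)" 
  shows "Re (cnj (out_normal n l) * (out_normal n m * cis \<phi>)) \<le> cos \<phi>"
proof -
  have "cnj (out_normal n l) * (out_normal n m * cis \<phi>) = cis (pi * real_of_int (int m - int l) / real n + \<phi>)"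
    by (simp add: out_normal_def cis_cnj cis_mult algebra_simps diff_divide_distrib)
  then show ?thesis using cos_sector_le[of n \<phi> "int m - int l"] assms n2 by simp
qed

lemma side_a_in_polygon: "l \<in> {1..2*n} \<Longrightarrow> side_a n l \<in> polygon n"
  unfolding polygon_def by (rule hull_inc) auto

lemma vtx_periodic: "vtx n (t + 2 * real n) = vtx n t"
proof -
  have "pi * (t + 2 * real n) / real n = pi * t / real n + 2 * pi" using n2 by (simp add: field_simps)
  then show ?thesis by (simp add: vtx_def flip: cis_mult)
qed

lemma vtx_antipode: "vtx n (t + real n) = - vtx n t"
proof -
  have "pi * (t + real n) / real n = pi * t / real n + pi" using n2 by (simp add: field_simps)
  then show ?thesis by (simp add: vtx_def flip: cis_mult)
qed

lemma side_b_eq_side_a: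
  "side_b n l = side_a n (Suc l)" "side_a n 1 = side_b n (2 * n)"
proof -
  show "side_b n l = side_a n (Suc l)" by (simp add: side_a_def side_b_def add.commute[of _ "1/2"])
  show "side_a n 1 = side_b n (2 * n)"
    using vtx_periodic[of "1/2"] by (simp add: side_a_def side_b_def add.commute[of _ "1/2"])
qed

lemma side_b_in_polygon: 
  assumes "l \<in> {1..2*n}" shows "side_b n l \<in> polygon n"
proof (cases "l = 2 * n")
  case True
  then show ?thesis using side_a_in_polygon[of 1] n2 side_b_eq_side_a(2) by simp
next
  case False
  then show ?thesis using side_a_in_polygon[of "Suc l"] assms side_b_eq_side_a(1) by simp
qed

lemma convex_polygon: "convex (polygon n)" and compact_polygon: "compact (polygon n)"
  unfolding polygon_def by (auto intro: finite_imp_compact_convex_hull)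

lemma closed_side_subset: "l \<in> {1..2*n} \<Longrightarrow> closed_segment (side_a n l) (side_b n l) \<subseteq> polygon n"
  by (intro closed_segment_subset convex_polygon side_a_in_polygon side_b_in_polygon)

lemma zero_in_polygon: "0 \<in> polygon n"
proof -
  have "side_a n (n + 1) = - side_a n 1"
    using vtx_antipode[of "1/2"] by (simp add: side_a_def algebra_simps)
  moreover have "side_a n 1 \<in> polygon n" "side_a n (n + 1) \<in> polygon n"
    using n2 by (auto intro!: side_a_in_polygon)
  ultimately have "(1/2) *\<^sub>R side_a n 1 + (1/2) *\<^sub>R (- side_a n 1) \<in> polygon n"
    by (intro convexD[OF convex_polygon]) auto
  then show ?thesis by simp
qed

text \<open>For the inclusion of the half-plane intersection in the hull, a point at angle phi in
  the sector of side \<open>m\<close> is a convex combination of the centre and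
  \<open>side_pt n m (tan \<phi>)\<close>. Its weight r cos phi is at most 1 by the half-plane of
  that same side.\<close>

lemma polygon_eq_halfplanes:
  "polygon n = {z. \<forall>l\<in>{1..2*n}. Re (cnj (out_normal n l) * z) \<le> 1}" (is "_ = ?H")
proof
  have half: "{z. \<forall>l\<in>{1..2*n}. Re (cnj (out_normal n l) * z) \<le> 1}
      = (\<Inter>l\<in>{1..2*n}. {z. inner (out_normal n l) z \<le> 1})"
    by (auto simp: inner_complex_def)
  have "convex ?H" unfolding half by (intro convex_INT convex_halfspace_le)
  moreover have "side_a n m \<in> ?H" for m
  proof -
    have "Re (cnj (out_normal n l) * side_a n m) \<le> 1" for l
    proof -
      define a where "a = pi / (2 * real n)"
      have c: "cos a > 0" using cos_half_angle_pos by (simp add: a_def)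
      have "side_a n m = complex_of_real (1 / cos a) * (out_normal n m * cis (-a))"
        using cis_div_cos[of "-a"] c by (simp add: side_ends side_pt_def a_def)
      then have "Re (cnj (out_normal n l) * side_a n m) = 1 / cos a * Re (cnj (out_normal n l) * (out_normal n m * cis (-a)))"
        by (simp add: field_simps)
      also have "\<dots> \<le> 1 / cos a * cos (-a)"
        using c half_angle by (intro mult_left_mono Re_normal_sector) (auto simp: a_def)
      finally show ?thesis using c by simp
    qed
    then show ?thesis by simp
  qed
  ultimately show "polygon n \<subseteq> ?H" unfolding polygon_def by (intro hull_minimal) auto
next
  show "?H \<subseteq> polygon n"
  proof
    fix z assume z: "z \<in> ?H"
    obtain m \<phi> where m: "m \<in> {1..2*n}" and \<phi>: "\<bar>\<phi>\<bar> \<le> pi / (2 * real n)"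
      and zz: "z = complex_of_real (cmod z) * (out_normal n m * cis \<phi>)"
      using polar_sector[of n z] n2 by auto
    define r where "r = cmod z"
    have c: "cos \<phi> > 0" using \<phi> by (rule cos_sector_pos)
    have "cnj (out_normal n m) * z = complex_of_real r * cis \<phi>"
      by (subst zz) (simp only: r_def mult.left_commute[of "cnj (out_normal n m)" "complex_of_real _"] cnj_out_normal)
    then have "Re (cnj (out_normal n m) * z) = r * cos \<phi>" by simp
    moreover have "Re (cnj (out_normal n m) * z) \<le> 1" using z m by blast
    ultimately have rc: "r * cos \<phi> \<le> 1" by linarith
    have rc0: "0 \<le> r * cos \<phi>" using c by (simp add: r_def)
    have "\<bar>tan \<phi>\<bar> \<le> tan (pi / (2 * real n))"
    proof -
      have "tan \<phi> \<le> tan (pi / (2 * real n))" "tan (-\<phi>) \<le> tan (pi / (2 * real n))"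
        using \<phi> half_angle by (subst tan_mono_le_eq; linarith)+
      then show ?thesis by simp
    qed
    then have "side_pt n m (tan \<phi>) \<in> closed_segment (side_a n m) (side_b n m)"
      unfolding closed_side by (auto simp: abs_le_iff)
    then have s: "side_pt n m (tan \<phi>) \<in> polygon n" using closed_side_subset[OF m] by blast
    have "z = (r * cos \<phi>) *\<^sub>R side_pt n m (tan \<phi>) + (1 - r * cos \<phi>) *\<^sub>R 0"
      using cis_div_cos[of \<phi>] c by (subst zz) (simp add: scaleR_conv_of_real side_pt_def r_def)
    also have "\<dots> \<in> polygon n"
      using rc rc0 s zero_in_polygon by (intro convexD[OF convex_polygon]) auto
    finally show "z \<in> polygon n" .
  qed
qed

lemma cball_subset_polygon: "cball 0 1 \<subseteq> polygon n"
proof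
  fix z :: complex assume z: "z \<in> cball 0 1"
  have "Re (cnj (out_normal n l) * z) \<le> 1" for l
    using complex_Re_le_cmod[of "cnj (out_normal n l) * z"] z by (simp add: norm_mult)
  then show "z \<in> polygon n" by (simp add: polygon_eq_halfplanes)
qed

lemma interior_polygon_halfplane:
  assumes "z \<in> interior (polygon n)" "l \<in> {1..2*n}"
  shows "Re (cnj (out_normal n l) * z) < 1"
proof -
  have "polygon n \<subseteq> {z. inner (out_normal n l) z \<le> 1}"
    using assms(2) by (auto simp: polygon_eq_halfplanes inner_complex_def)
  from interior_mono[OF this] assms(1) have "z \<in> interior {z. inner (out_normal n l) z \<le> 1}" by blast
  then have "inner (out_normal n l) z < 1"
    by (subst (asm) interior_halfspace_le) auto
  then show ?thesis by (simp add: inner_complex_def)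
qed

text \<open>If r cos phi < 1 in the sector of the point, then all 2n half-plane inequalities are
  strict there, and the finite intersection of open half-planes is a neighbourhood inside the
  polygon. So a boundary point has r cos phi = 1 and lies on the side of its sector.\<close>

lemma polygon_boundary_cases:
  assumes "z \<in> polygon n" "z \<notin> interior (polygon n)"
  obtains l where "l \<in> {1..2*n}" "z \<in> closed_segment (side_a n l) (side_b n l)"
proof -
  obtain m \<phi> where m: "m \<in> {1..2*n}" and \<phi>: "\<bar>\<phi>\<bar> \<le> pi / (2 * real n)"
    and zz: "z = complex_of_real (cmod z) * (out_normal n m * cis \<phi>)"
    using polar_sector[of n z] n2 by auto
  define r where "r = cmod z"
  have c: "cos \<phi> > 0" using \<phi> by (rule cos_sector_pos)
  have Re_eq: "Re (cnj (out_normal n l) * z) = r * Re (cnj (out_normal n l) * (out_normal n m * cis \<phi>))" for l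
  proof -
    have "cnj (out_normal n l) * z = r *\<^sub>R (cnj (out_normal n l) * (out_normal n m * cis \<phi>))"
      by (subst zz) (simp only: scaleR_conv_of_real r_def mult.left_commute[of "cnj _"])
    then show ?thesis by (simp only: scaleR_complex.sel)
  qed
  have "r * cos \<phi> = 1"
  proof (rule ccontr)
    assume ne: "r * cos \<phi> \<noteq> 1"
    have "Re (cnj (out_normal n m) * z) = r * cos \<phi>" unfolding Re_eq by simp
    moreover have "Re (cnj (out_normal n m) * z) \<le> 1"
      using assms(1) m unfolding polygon_eq_halfplanes by blast
    ultimately have "r * cos \<phi> \<le> 1" by linarith
    then have lt: "r * cos \<phi> < 1" using ne by simp
    define O1 where "O1 = (\<Inter>l\<in>{1..2*n}. {z. inner (out_normal n l) z < 1})"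
    have "open O1" unfolding O1_def by (intro open_INT ballI open_halfspace_lt) simp
    moreover have "O1 \<subseteq> polygon n"
      unfolding O1_def polygon_eq_halfplanes by (auto simp: inner_complex_def intro: less_imp_le)
    moreover have "z \<in> O1"
    proof -
      have "Re (cnj (out_normal n l) * z) < 1" for l
      proof -
        have "Re (cnj (out_normal n l) * z) \<le> r * cos \<phi>"
          unfolding Re_eq by (intro mult_left_mono Re_normal_sector \<phi>) (simp add: r_def)
        then show ?thesis using lt by simp
      qed
      then show ?thesis by (simp add: O1_def inner_complex_def)
    qed
    ultimately show False using assms(2) interiorI by blast
  qed
  then have "z = side_pt n m (tan \<phi>)"
    using cis_div_cos[of \<phi>] c by (subst zz) (simp add: side_pt_def r_def mult.left_commute flip: of_real_mult mult.assoc)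
  moreover have "\<bar>tan \<phi>\<bar> \<le> tan (pi / (2 * real n))"
  proof -
    have "tan \<phi> \<le> tan (pi / (2 * real n))" "tan (-\<phi>) \<le> tan (pi / (2 * real n))"
      using \<phi> half_angle by (subst tan_mono_le_eq; linarith)+
    then show ?thesis by simp
  qed
  ultimately have "z \<in> closed_segment (side_a n m) (side_b n m)"
    unfolding closed_side by (auto simp: abs_le_iff)
  then show ?thesis using m that by blast
qed

text \<open>A unit step inward from a side lands at distance |y| <= tan (pi/(2n)) <= 1 from the
  centre, hence in the inscribed disc; convexity covers the shorter steps. This makes the inward
  segments used by \<open>outward_nd\<close> lie in the polygon.\<close>

lemma inward_normal_in_polygon:
  assumes "l \<in> {1..2*n}" "z \<in> closed_segment (side_a n l) (side_b n l)" "0 \<le> t" "t \<le> 1"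
  shows "z - complex_of_real t * out_normal n l \<in> polygon n"
proof -
  obtain y where y: "z = side_pt n l y" "\<bar>y\<bar> \<le> tan (pi / (2 * real n))"
    using assms(2) unfolding closed_side by auto
  have "z - out_normal n l = out_normal n l * (\<i> * complex_of_real y)"
    by (simp add: y side_pt_def complex_eq_iff algebra_simps)
  then have "z - out_normal n l \<in> cball 0 1"
    using y(2) tan_half_angle by (simp add: norm_mult)
  then have "z - out_normal n l \<in> polygon n" using cball_subset_polygon by blast
  moreover have "z \<in> polygon n" using assms closed_side_subset by blast
  ultimately have "(1 - t) *\<^sub>R z + t *\<^sub>R (z - out_normal n l) \<in> polygon n"
    using assms by (intro convexD[OF convex_polygon]) auto
  moreover have "(1 - t) *\<^sub>R z + t *\<^sub>R (z - out_normal n l) = z - complex_of_real t * out_normal n l"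
    by (simp add: scaleR_conv_of_real algebra_simps)
  ultimately show ?thesis by simp
qed

end

section \<open>Uniqueness for the mixed boundary value problem\<close>

text \<open>Relative to sets \<open>A\<close> and \<open>B\<close> because it is also applied on the
  sides, where derivatives exist only within the closed polygon.\<close>

lemma has_vector_derivative_along_line:
  assumes "(f has_field_derivative D) (at (z + c * complex_of_real t) within A)"
    and "\<And>s. s \<in> B \<Longrightarrow> z + c * complex_of_real s \<in> A"
  shows "((\<lambda>s. f (z + c * complex_of_real s)) has_vector_derivative c * D) (at t within B)"
proof -
  have "((\<lambda>s. z + c * complex_of_real s) has_vector_derivative c) (at t within B)"
    by (auto intro!: derivative_eq_intros)
  moreover have "(f has_field_derivative D) (at (z + c * complex_of_real t) within (\<lambda>s. z + c * complex_of_real s) ` B)"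
    using assms by (blast intro: DERIV_subset)
  ultimately show ?thesis
    by (rule field_vector_diff_chain_within[unfolded o_def])
qed

lemma has_real_derivative_Re:
  "(f has_vector_derivative D) F \<Longrightarrow> ((\<lambda>t. Re (f t)) has_real_derivative Re D) F"
  unfolding has_real_derivative_iff_has_vector_derivative
  by (rule bounded_linear.has_vector_derivative[OF bounded_linear_Re])

lemma has_real_derivative_Im:
  "(f has_vector_derivative D) F \<Longrightarrow> ((\<lambda>t. Im (f t)) has_real_derivative Im D) F"
  unfolding has_real_derivative_iff_has_vector_derivative
  by (rule bounded_linear.has_vector_derivative[OF bounded_linear_Im])

lemma second_derivative_local_max:
  fixes u :: "real \<Rightarrow> real"
  assumes "d > 0" and u: "\<And>t. \<bar>t\<bar> < d \<Longrightarrow> (u has_real_derivative u' t) (at t)"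
    and u': "(u' has_real_derivative L) (at 0)"
    and max: "\<And>t. \<bar>t\<bar> < d \<Longrightarrow> u t \<le> u 0"
  shows "L \<le> 0"
proof (rule ccontr)
  assume "\<not> L \<le> 0"
  then obtain e where e: "e > 0" "\<And>h. 0 < h \<Longrightarrow> h < e \<Longrightarrow> u' 0 < u' h"
    using DERIV_pos_inc_right[OF u'] by auto
  have z: "u' 0 = 0"
    using DERIV_local_max[OF u[of 0] \<open>d > 0\<close>] max \<open>d > 0\<close> by auto
  define t where "t = min d e / 2"
  have t: "0 < t" "t < d" "t < e" using e \<open>d > 0\<close> by (auto simp: t_def min_def)
  obtain x where "0 < x" "x < t" "u t - u 0 = (t - 0) * u' x"
    using MVT2[OF t(1), of u u'] u t by auto
  then have "u t > u 0" using e(2)[of x] z t by (simp add: algebra_simps zero_less_mult_iff) 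
  then show False using max[of t] t by auto
qed

text \<open>Names the tuple of witnesses in \<open>harmonic_on\<close>, so that harmonic functions
  can be subtracted component by component.\<close>

definition harmonic_partials where
  "harmonic_partials S V Vx Vy Vxx Vxy Vyx Vyy \<longleftrightarrow>
     continuous_on S Vx \<and> continuous_on S Vy \<and> continuous_on S Vxx \<and> continuous_on S Vxy \<and>
     continuous_on S Vyx \<and> continuous_on S Vyy \<and>
     (\<forall>z\<in>S. ((\<lambda>t. V (z + complex_of_real t)) has_real_derivative Vx z) (at 0) \<and>
        ((\<lambda>t. V (z + \<i> * complex_of_real t)) has_real_derivative Vy z) (at 0) \<and>
        ((\<lambda>t. Vx (z + complex_of_real t)) has_real_derivative Vxx z) (at 0) \<and>
        ((\<lambda>t. Vx (z + \<i> * complex_of_real t)) has_real_derivative Vxy z) (at 0) \<and>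
        ((\<lambda>t. Vy (z + complex_of_real t)) has_real_derivative Vyx z) (at 0) \<and>
        ((\<lambda>t. Vy (z + \<i> * complex_of_real t)) has_real_derivative Vyy z) (at 0) \<and>
        Vxx z + Vyy z = 0)"

lemma harmonic_on_iff_partials:
  "harmonic_on S V \<longleftrightarrow> open S \<and> (\<exists>Vx Vy Vxx Vxy Vyx Vyy. harmonic_partials S V Vx Vy Vxx Vxy Vyx Vyy)"
  unfolding harmonic_on_def harmonic_partials_def by blast

lemma harmonic_partials_diff:
  assumes "harmonic_partials S V Vx Vy Vxx Vxy Vyx Vyy" "harmonic_partials S W Wx Wy Wxx Wxy Wyx Wyy"
  shows "harmonic_partials S (\<lambda>z. V z - W z) (\<lambda>z. Vx z - Wx z) (\<lambda>z. Vy z - Wy z)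
    (\<lambda>z. Vxx z - Wxx z) (\<lambda>z. Vxy z - Wxy z) (\<lambda>z. Vyx z - Wyx z) (\<lambda>z. Vyy z - Wyy z)"
  using assms unfolding harmonic_partials_def
  by (intro conjI ballI continuous_on_diff DERIV_diff) (auto simp: diff_add_eq_diff_diff_swap add_eq_0_iff)

lemma harmonic_on_diff:
  "harmonic_on S V \<Longrightarrow> harmonic_on S W \<Longrightarrow> harmonic_on S (\<lambda>z. V z - W z)"
  unfolding harmonic_on_iff_partials by (blast intro: harmonic_partials_diff)

text \<open>The perturbed function has Laplacian 4 epsilon delta > 0, since Re w^n is harmonic; at
  an interior maximum both pure second derivatives would be nonpositive.\<close>

lemma harmonic_perturbed_no_max:
  assumes W: "harmonic_on S W" and "z \<in> S" "\<epsilon> > 0" "\<delta> > 0"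
    and max: "\<And>w. w \<in> S \<Longrightarrow>
      W w + \<epsilon> * (Re (w ^ n) + \<delta> * ((Re w)\<^sup>2 + (Im w)\<^sup>2)) \<le> W z + \<epsilon> * (Re (z ^ n) + \<delta> * ((Re z)\<^sup>2 + (Im z)\<^sup>2))"
  shows False
proof -
  obtain Wx Wy Wxx Wxy Wyx Wyy where D:
    "\<And>z. z\<in>S \<Longrightarrow> ((\<lambda>t. W (z + complex_of_real t)) has_real_derivative Wx z) (at 0)"
    "\<And>z. z\<in>S \<Longrightarrow> ((\<lambda>t. W (z + \<i> * complex_of_real t)) has_real_derivative Wy z) (at 0)"
    "\<And>z. z\<in>S \<Longrightarrow> ((\<lambda>t. Wx (z + complex_of_real t)) has_real_derivative Wxx z) (at 0)"
    "\<And>z. z\<in>S \<Longrightarrow> ((\<lambda>t. Wy (z + \<i> * complex_of_real t)) has_real_derivative Wyy z) (at 0)"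
    "\<And>z. z\<in>S \<Longrightarrow> Wxx z + Wyy z = 0"
    and "open S"
  proof -
    obtain Wx Wy Wxx Wxy Wyx Wyy where "harmonic_partials S W Wx Wy Wxx Wxy Wyx Wyy" "open S"
      using W unfolding harmonic_on_iff_partials by blast
    then show ?thesis using that[of Wx Wy Wxx Wyy] unfolding harmonic_partials_def by blast
  qed
  obtain d where d: "d > 0" "ball z d \<subseteq> S" using \<open>z \<in> S\<close> \<open>open S\<close> open_contains_ball by blast
  have inS: "z + complex_of_real t \<in> S" "z + \<i> * complex_of_real t \<in> S" if "\<bar>t\<bar> < d" for t
    using that d(2) by (auto simp: subset_iff dist_norm norm_mult)
  define A where "A = real n * real (n - 1)"
  define P where "P = (\<lambda>c w. Re (c * (of_nat n * w ^ (n - 1))))"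
  have pw: "((\<lambda>t. Re ((z + c * complex_of_real t) ^ n)) has_real_derivative P c (z + c * complex_of_real t)) (at t)" for c t
    unfolding P_def
    by (intro has_real_derivative_Re has_vector_derivative_along_line[where A = UNIV])
       (auto intro!: derivative_eq_intros)
  have pw2: "((\<lambda>t. P c (z + c * complex_of_real t)) has_real_derivative
      Re (c^2 * (of_nat n * (of_nat (n-1) * z ^ (n - 2))))) (at 0)" for c
  proof -
    have "((\<lambda>w. c * (of_nat n * w ^ (n - 1))) has_field_derivative
        c * (of_nat n * (of_nat (n - 1) * z ^ (n - 2)))) (at (z + c * complex_of_real 0) within UNIV)"
      by (auto intro!: derivative_eq_intros simp: numeral_2_eq_2)
    from has_real_derivative_Re[OF has_vector_derivative_along_line[OF this]] show ?thesis
      unfolding P_def by (simp add: power2_eq_square mult.assoc)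
  qed
  \<comment> \<open>The factor \<open>1^2\<close> is kept visible to match \<open>\<i>^2\<close> in
    the vertical direction: the two contributions of Re w^n cancel when the inequalities are
    added.\<close>
  have "Wxx z + \<epsilon> * (Re (1^2 * (of_nat n * (of_nat (n-1) * z ^ (n - 2)))) + \<delta> * 2) \<le> 0"
  proof (rule second_derivative_local_max[OF d(1)])
    fix t assume t: "\<bar>t\<bar> < d"
    have "((\<lambda>t. W (z + complex_of_real t)) has_real_derivative Wx (z + complex_of_real t)) (at t)"
      using D(1)[OF inS(1)[OF t]] DERIV_shift[of "\<lambda>t. W (z + complex_of_real t)" _ 0 t]
      by (simp add: add_ac)
    moreover have q: "((\<lambda>t. (Re (z + complex_of_real t))\<^sup>2 + (Im (z + complex_of_real t))\<^sup>2)
        has_real_derivative 2 * (Re z + t)) (at t)"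
      by (auto intro!: derivative_eq_intros)
    ultimately show "((\<lambda>t. W (z + complex_of_real t) + \<epsilon> * (Re ((z + 1 * complex_of_real t) ^ n) + 
        \<delta> * ((Re (z + complex_of_real t))\<^sup>2 + (Im (z + complex_of_real t))\<^sup>2))) has_real_derivative
       (Wx (z + complex_of_real t) + \<epsilon> * (P 1 (z + 1 * complex_of_real t) + \<delta> * (2 * (Re z + t))))) (at t)"
      by (intro DERIV_add DERIV_cmult pw)
  next
    show "((\<lambda>t. Wx (z + complex_of_real t) + \<epsilon> * (P 1 (z + 1 * complex_of_real t) + \<delta> * (2 * (Re z + t)))) has_real_derivative
      Wxx z + \<epsilon> * (Re (1^2 * (of_nat n * (of_nat (n-1) * z ^ (n - 2)))) + \<delta> * 2)) (at 0)"
      by (rule derivative_eq_intros D(3) pw2 \<open>z \<in> S\<close> refl | simp)+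
  next
    fix t assume t: "\<bar>t\<bar> < d"
    show "W (z + complex_of_real t) + \<epsilon> * (Re ((z + 1 * complex_of_real t) ^ n) + 
        \<delta> * ((Re (z + complex_of_real t))\<^sup>2 + (Im (z + complex_of_real t))\<^sup>2))
       \<le> W (z + complex_of_real 0) + \<epsilon> * (Re ((z + 1 * complex_of_real 0) ^ n) + 
        \<delta> * ((Re (z + complex_of_real 0))\<^sup>2 + (Im (z + complex_of_real 0))\<^sup>2))"
      using max[OF inS(1)[OF t]] by simp
  qed
  moreover have "Wyy z + \<epsilon> * (Re (\<i>^2 * (of_nat n * (of_nat (n-1) * z ^ (n - 2)))) + \<delta> * 2) \<le> 0"
  proof (rule second_derivative_local_max[OF d(1)])
    fix t assume t: "\<bar>t\<bar> < d"
    have "((\<lambda>t. W (z + \<i> * complex_of_real t)) has_real_derivative Wy (z + \<i> * complex_of_real t)) (at t)"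
      using D(2)[OF inS(2)[OF t]] DERIV_shift[of "\<lambda>t. W (z + \<i> * complex_of_real t)" _ 0 t]
      by (simp add: algebra_simps)
    moreover have q: "((\<lambda>t. (Re (z + \<i> * complex_of_real t))\<^sup>2 + (Im (z + \<i> * complex_of_real t))\<^sup>2)
        has_real_derivative 2 * (Im z + t)) (at t)"
      by (auto intro!: derivative_eq_intros)
    ultimately show "((\<lambda>t. W (z + \<i> * complex_of_real t) + \<epsilon> * (Re ((z + \<i> * complex_of_real t) ^ n) + 
        \<delta> * ((Re (z + \<i> * complex_of_real t))\<^sup>2 + (Im (z + \<i> * complex_of_real t))\<^sup>2))) has_real_derivative
       (Wy (z + \<i> * complex_of_real t) + \<epsilon> * (P \<i> (z + \<i> * complex_of_real t) + \<delta> * (2 * (Im z + t))))) (at t)"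
      by (intro DERIV_add DERIV_cmult pw)
  next
    show "((\<lambda>t. Wy (z + \<i> * complex_of_real t) + \<epsilon> * (P \<i> (z + \<i> * complex_of_real t) + \<delta> * (2 * (Im z + t)))) has_real_derivative
      Wyy z + \<epsilon> * (Re (\<i>^2 * (of_nat n * (of_nat (n-1) * z ^ (n - 2)))) + \<delta> * 2)) (at 0)"
      by (rule derivative_eq_intros D(4) pw2 \<open>z \<in> S\<close> refl | simp)+
  next
    fix t assume t: "\<bar>t\<bar> < d"
    show "W (z + \<i> * complex_of_real t) + \<epsilon> * (Re ((z + \<i> * complex_of_real t) ^ n) + 
        \<delta> * ((Re (z + \<i> * complex_of_real t))\<^sup>2 + (Im (z + \<i> * complex_of_real t))\<^sup>2))
       \<le> W (z + \<i> * complex_of_real 0) + \<epsilon> * (Re ((z + \<i> * complex_of_real 0) ^ n) + 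
        \<delta> * ((Re (z + \<i> * complex_of_real 0))\<^sup>2 + (Im (z + \<i> * complex_of_real 0))\<^sup>2))"
      using max[OF inS(2)[OF t]] by simp
  qed
  ultimately have "Wxx z + Wyy z + 4 * \<epsilon> * \<delta> \<le> 0" by (simp add: algebra_simps)
  then show False using D(5)[OF \<open>z \<in> S\<close>] assms by (simp add: mult_le_0_iff)
qed

section \<open>Barrier on the free edges and comparison of two solutions\<close>

context
  fixes n :: nat
  assumes n2: "n \<ge> 2"
begin

text \<open>Write s = sin (pi/(2n)). On an odd side the inward derivative of Re z^n is n Re (1 + i
  y)^(n-1) >= n s, while that of (s/2) |z|^2 is exactly -s, because z has component 1 along the
  normal. The total is at least (n - 1) s > 0, which explains the weight s/2.\<close>

lemma free_side_normal_derivative: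
  assumes "odd l" "z \<in> open_segment (side_a n l) (side_b n l)"
  obtains c where "c > 0"
    "((\<lambda>t. Re ((z - complex_of_real t * out_normal n l) ^ n)
        + sin (pi / (2 * real n)) / 2 * ((Re (z - complex_of_real t * out_normal n l))\<^sup>2 + (Im (z - complex_of_real t * out_normal n l))\<^sup>2))
       has_real_derivative c) (at_right 0)"
proof -
  define s where "s = sin (pi / (2 * real n))"
  define \<nu> where "\<nu> = out_normal n l"
  have s: "s > 0" using half_angle[OF n2] by (auto simp: s_def intro!: sin_gt_zero)
  obtain y where y: "z = side_pt n l y" "\<bar>y\<bar> < tan (pi / (2 * real n))"
    using assms(2) unfolding open_side[OF n2] by auto
  define \<phi> where "\<phi> = arctan y"
  have "\<bar>\<phi>\<bar> < arctan (tan (pi / (2 * real n)))"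
    using y(2) unfolding \<phi>_def abs_less_iff by (simp only: arctan_minus[symmetric] arctan_less_iff)
  then have \<phi>: "\<bar>\<phi>\<bar> < pi / (2 * real n)"
    using half_angle[OF n2] by (simp add: arctan_tan)
  have c: "cos \<phi> > 0" "cos \<phi> \<le> 1" using cos_sector_pos[OF n2, of \<phi>] \<phi> by auto
  have 1: "Complex 1 y = complex_of_real (1 / cos \<phi>) * cis \<phi>"
    using c cis_div_cos[OF n2, of \<phi>] by (simp add: \<phi>_def tan_arctan)
  have "Complex 1 y ^ (n - 1) = complex_of_real ((1 / cos \<phi>) ^ (n - 1)) * cis (real (n - 1) * \<phi>)"
    by (simp only: 1 power_mult_distrib Complex.DeMoivre of_real_power)
  then have R: "Re (Complex 1 y ^ (n - 1)) = (1 / cos \<phi>) ^ (n - 1) * cos (real (n - 1) * \<phi>)"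
    by simp
  \<comment> \<open>The angle of (1 + i y)^(n-1) stays within pi/2 - pi/(2n), so its cosine is at
    least sin (pi/(2n)).\<close>
  have "\<bar>real (n - 1) * \<phi>\<bar> \<le> real (n - 1) * (pi / (2 * real n))"
    unfolding abs_mult using \<phi> by (intro mult_mono) auto
  also have "\<dots> = pi / 2 - pi / (2 * real n)" using n2 by (simp add: of_nat_diff field_simps)
  finally have "cos (pi / 2 - pi / (2 * real n)) \<le> cos \<bar>real (n - 1) * \<phi>\<bar>"
    using half_angle[OF n2] by (intro cos_monotone_0_pi_le) auto
  then have "s \<le> cos (real (n - 1) * \<phi>)" unfolding s_def sin_cos_eq by simp
  moreover have "1 \<le> (1 / cos \<phi>) ^ (n - 1)" using c by (intro one_le_power) simp
  ultimately have Rs: "s \<le> Re (Complex 1 y ^ (n - 1))"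
    unfolding R using s mult_mono[of 1 "(1 / cos \<phi>) ^ (n - 1)" s "cos (real (n - 1) * \<phi>)"] by simp
  have "\<nu> ^ n = cis (pi * real l)" using n2 by (simp add: \<nu>_def out_normal_def Complex.DeMoivre)
  also have "\<dots> = -1" using assms(1) cos_npi2[of l] sin_npi2[of l] by (simp add: complex_eq_iff)
  finally have nun: "\<nu> ^ n = -1" .
  \<comment> \<open>Only here does the parity of \<open>l\<close> enter: the power n of the normal
    is -1, so Re z^n decreases outward on free edges.\<close>
  have "\<nu> * z ^ (n - 1) = \<nu> ^ n * Complex 1 y ^ (n - 1)"
  proof -
    have "\<nu> ^ n = \<nu> * \<nu> ^ (n - 1)" using n2 by (simp flip: power_Suc)
    then show ?thesis by (simp only: y side_pt_def \<nu>_def power_mult_distrib mult.assoc)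
  qed
  then have nz: "\<nu> * z ^ (n - 1) = - (Complex 1 y ^ (n - 1))" by (simp add: nun)
  have r1: "Re \<nu> * Re z + Im \<nu> * Im z = 1" using Re_side_pt[OF n2, of l y] by (simp add: y \<nu>_def)
  define c where "c = real n * Re (Complex 1 y ^ (n - 1)) - s"
  have "s < real n * s" using n2 s by simp
  also have "\<dots> \<le> real n * Re (Complex 1 y ^ (n - 1))" using Rs by (simp add: mult_left_mono)
  finally have "c > 0" by (simp add: c_def)
  moreover have "((\<lambda>t. Re ((z - complex_of_real t * \<nu>) ^ n)
        + s / 2 * ((Re (z - complex_of_real t * \<nu>))\<^sup>2 + (Im (z - complex_of_real t * \<nu>))\<^sup>2))
       has_real_derivative c) (at_right 0)"
  proof -
    have "((\<lambda>w. w ^ n) has_field_derivative of_nat n * z ^ (n - 1)) (at (z + - \<nu> * complex_of_real 0) within UNIV)"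
      by (auto intro!: derivative_eq_intros)
    from has_vector_derivative_along_line[OF this]
    have "((\<lambda>t. (z - complex_of_real t * \<nu>) ^ n) has_vector_derivative - (of_nat n * (\<nu> * z ^ (n - 1)))) (at_right 0)"
      by (simp add: mult.commute mult.left_commute)
    then have "((\<lambda>t. Re ((z - complex_of_real t * \<nu>) ^ n)) has_real_derivative Re (- (of_nat n * (\<nu> * z ^ (n - 1))))) (at_right 0)"
      by (rule has_real_derivative_Re)
    then have "((\<lambda>t. Re ((z - complex_of_real t * \<nu>) ^ n)) has_real_derivative real n * Re (Complex 1 y ^ (n - 1))) (at_right 0)"
      unfolding nz by simp
    moreover have "((\<lambda>t. s / 2 * ((Re (z - complex_of_real t * \<nu>))\<^sup>2 + (Im (z - complex_of_real t * \<nu>))\<^sup>2))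
       has_real_derivative - s * (Re \<nu> * Re z + Im \<nu> * Im z)) (at_right 0)"
      by (auto intro!: derivative_eq_intros simp: field_simps)
    ultimately have "((\<lambda>t. Re ((z - complex_of_real t * \<nu>) ^ n)
        + s / 2 * ((Re (z - complex_of_real t * \<nu>))\<^sup>2 + (Im (z - complex_of_real t * \<nu>))\<^sup>2))
       has_real_derivative real n * Re (Complex 1 y ^ (n - 1)) + - s * (Re \<nu> * Re z + Im \<nu> * Im z)) (at_right 0)"
      by (rule DERIV_add)
    then show ?thesis by (simp only: c_def r1 mult_1_right diff_conv_add_uminus)
  qed
  ultimately show ?thesis using that unfolding s_def \<nu>_def by blast
qed

text \<open>Perturbing \<open>V - W\<close> by \<open>\<epsilon> (Re z\<^sup>n + \<delta> \<bar>z\<bar>\<^sup>2)\<close> makes it strictly subharmonic with strictly negative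
  outward derivative on the free sides, where \<open>Re z\<^sup>n\<close> itself has negative outward derivative.
  Its maximum is then attained on a node.\<close>

lemma bvp_le:
  assumes V: "bvp n v V" and W: "bvp n v W" and z: "z \<in> polygon n"
  shows "V z \<le> W z"
proof -
  define \<delta> where "\<delta> = sin (pi / (2 * real n)) / 2"
  have \<delta>: "\<delta> > 0" using half_angle[OF n2] by (auto simp: \<delta>_def intro!: sin_gt_zero)
  define G where "G = (\<lambda>w. Re (w ^ n) + \<delta> * ((Re w)\<^sup>2 + (Im w)\<^sup>2))"
  have contG: "continuous_on A G" for A unfolding G_def by (intro continuous_intros)
  \<comment> \<open>A bound independent of epsilon. Once the perturbed difference is known to have
    its maximum where \<open>D\<close> vanishes, \<open>D z\<close> is at most epsilon times
    \<open>C\<close>, and epsilon tends to 0.\<close>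
  define C where "C = Sup (G ` polygon n) - G z"
  have GC: "G w - G z \<le> C" if "w \<in> polygon n" for w
    unfolding C_def using that compact_continuous_image[OF contG compact_polygon[OF n2]]
    by (auto intro!: cSup_upper bounded_imp_bdd_above compact_imp_bounded)
  define D where "D = (\<lambda>w. V w - W w)"
  have D: "continuous_on (polygon n) D" "harmonic_on (interior (polygon n)) D"
    using V W unfolding D_def bvp_def by (auto intro: continuous_on_diff harmonic_on_diff)
  have node: "D w = 0" if "j \<in> {1..n}" "w \<in> closed_segment (side_a n (2*j)) (side_b n (2*j))" for j w
    using V W that unfolding D_def bvp_def by auto
  have free: "((\<lambda>t. D (w - complex_of_real t * out_normal n (2*j-1))) has_real_derivative 0) (at_right 0)"
    if "j \<in> {1..n}" "w \<in> open_segment (side_a n (2*j-1)) (side_b n (2*j-1))" for j w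
  proof -
    have "outward_nd V (out_normal n (2*j-1)) w 0" "outward_nd W (out_normal n (2*j-1)) w 0"
      using V W that unfolding bvp_def by blast+
    then show ?thesis unfolding D_def outward_nd_def
      by (auto dest: DERIV_diff)
  qed
  have bound: "D z \<le> \<epsilon> * C" if \<epsilon>: "\<epsilon> > 0" for \<epsilon>
  proof -
    have "continuous_on (polygon n) (\<lambda>w. D w + \<epsilon> * G w)"
      by (intro continuous_intros D contG)
    then obtain m where m: "m \<in> polygon n" and mmax: "\<And>w. w \<in> polygon n \<Longrightarrow> D w + \<epsilon> * G w \<le> D m + \<epsilon> * G m"
      using continuous_attains_sup[OF compact_polygon[OF n2]] z by blast
    have "m \<notin> interior (polygon n)"
    proof
      assume "m \<in> interior (polygon n)"
      then show False
        using harmonic_perturbed_no_max[OF D(2) _ \<epsilon> \<delta>, of m n] mmax interior_subset unfolding G_def by blast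
    qed
    then obtain l where l: "l \<in> {1..2*n}" "m \<in> closed_segment (side_a n l) (side_b n l)"
      using polygon_boundary_cases[OF n2 m] by blast
    \<comment> \<open>Corners of a free edge belong to the neighbouring nodes, so they are Dirichlet
      points. Inside a free edge the perturbed difference has inward derivative epsilon c > 0 and
      would exceed its maximum.\<close>
    have "D m = 0"
    proof (cases "even l")
      case True
      then show ?thesis using l node[of "l div 2" m] by auto
    next
      case False
      define j where "j = (l + 1) div 2"
      have j: "j \<in> {1..n}" "l = 2 * j - 1" using False l(1) by (auto simp: j_def elim!: oddE)
      consider "m = side_a n l" | "m = side_b n l" | "m \<in> open_segment (side_a n l) (side_b n l)"
        using l(2) unfolding open_segment_def by blast
      then show ?thesis
      proof cases
        case 1
        show ?thesis
        \<comment> \<open>The predecessor of side 1 in cyclic order is node n, that is, side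
          2n.\<close>
        proof (cases "l = 1")
          case True
          then have "m = side_b n (2 * n)" using 1 side_b_eq_side_a(2)[OF n2] by simp
          then show ?thesis using node[of n m] n2 by simp
        next
          case False
          then have "l = Suc (2 * (j - 1))" "j - 1 \<in> {1..n}" using j by auto
          then have "m = side_b n (2 * (j - 1))" "j - 1 \<in> {1..n}"
            using 1 side_b_eq_side_a(1)[OF n2] by metis+
          then show ?thesis using node[of "j-1" m] by simp
        qed
      next
        case 2
        then have "m = side_a n (2 * j)"
          using side_b_eq_side_a(1)[OF n2, of l] j by (auto simp: Suc_diff_le)
        then show ?thesis using node[of j m] j by simp
      next
        case 3
        define \<nu> where "\<nu> = out_normal n l"
        obtain c where c: "c > 0" "((\<lambda>t. G (m - complex_of_real t * \<nu>)) has_real_derivative c) (at_right 0)"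
          using free_side_normal_derivative[OF False 3] unfolding G_def \<delta>_def \<nu>_def by blast
        have "((\<lambda>t. D (m - complex_of_real t * \<nu>)) has_real_derivative 0) (at_right 0)"
          using free[OF j(1), of m] 3 unfolding \<nu>_def j(2) by blast
        then have "((\<lambda>t. D (m - complex_of_real t * \<nu>) + \<epsilon> * G (m - complex_of_real t * \<nu>)) has_real_derivative \<epsilon> * c) (at_right 0)"
          using c(2) by (auto intro!: derivative_eq_intros)
        then obtain e where e: "e > 0" "\<And>h. 0 < h \<Longrightarrow> h < e \<Longrightarrow>
           D m + \<epsilon> * G m < D (m - complex_of_real h * \<nu>) + \<epsilon> * G (m - complex_of_real h * \<nu>)"
          using has_real_derivative_pos_inc_right[of _ "\<epsilon> * c" 0 "{0<..}"] c \<epsilon> by force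
        define h where "h = min e 1 / 2"
        have h: "0 < h" "h < e" "h \<le> 1" using e by (auto simp: h_def)
        have "m - complex_of_real h * \<nu> \<in> polygon n"
          unfolding \<nu>_def using inward_normal_in_polygon[OF n2 l] h by simp
        then show ?thesis using e(2)[of h] h mmax by force
      qed
    qed
    then show ?thesis using mmax[OF z] mult_left_mono[OF GC[OF m], of \<epsilon>] \<epsilon>
      by (simp add: algebra_simps)
  qed
  have C0: "C \<ge> 0" using GC[OF z] by simp
  have "D z \<le> 0"
  proof (rule field_le_epsilon)
    fix e :: real assume e: "e > 0"
    have "D z \<le> e / (C + 1) * C" using e C0 by (intro bound) simp
    also have "\<dots> \<le> e" using e C0 by (simp add: field_simps)
    finally show "D z \<le> 0 + e" by simp
  qed
  then show ?thesis by (simp add: D_def)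
qed

lemma bvp_unique:
  "bvp n v V \<Longrightarrow> bvp n v W \<Longrightarrow> z \<in> polygon n \<Longrightarrow> V z = W z"
  by (intro antisym bvp_le)

end

section \<open>Ray integrals of Schwarz--Christoffel type\<close>

text \<open>With m = 1 and s = 1/n each root of w^(2n) = -1 produces an exterior angle pi/n; with s
  = 1/2 it produces the quarter turn between wired and free conditions.\<close>

definition sc_deriv :: "nat \<Rightarrow> nat \<Rightarrow> real \<Rightarrow> complex \<Rightarrow> complex" where
  "sc_deriv n m s w = w ^ (m - 1) * (1 + w ^ (2 * n)) powr - complex_of_real s"

definition sc_int :: "nat \<Rightarrow> nat \<Rightarrow> real \<Rightarrow> complex \<Rightarrow> complex" where
  "sc_int n m s w = integral {0..1} (\<lambda>t. w * sc_deriv n m s (complex_of_real t * w))"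

text \<open>The plane slit along the rays from the roots of w^(2n) = -1 to infinity. It contains the
  closed disc without those roots, so the maps are holomorphic across the open boundary
  arcs.\<close>

definition sc_dom :: "nat \<Rightarrow> complex set" where
  "sc_dom n = {w. 1 + w ^ (2 * n) \<notin> \<real>\<^sub>\<le>\<^sub>0}"

text \<open>The real integral left over when the ray ends where w^(2n) = c: at a side midpoint for c
  = 1, at a vertex for c = -1.\<close>

definition sc_radial :: "nat \<Rightarrow> nat \<Rightarrow> real \<Rightarrow> real \<Rightarrow> real" where
  "sc_radial n m s c = integral {0..1} (\<lambda>t. t ^ (m - 1) * (1 + c * t ^ (2 * n)) powr - s)"

lemma open_sc_dom: "open (sc_dom n)"
proof -
  have "sc_dom n = (\<lambda>w. 1 + w ^ (2 * n)) -` (- \<real>\<^sub>\<le>\<^sub>0)" by (auto simp: sc_dom_def)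
  moreover have "open ((\<lambda>w::complex. 1 + w ^ (2 * n)) -` (- \<real>\<^sub>\<le>\<^sub>0))"
    by (intro open_vimage continuous_intros open_Compl closed_nonpos_Reals_complex)
  ultimately show ?thesis by simp
qed

lemma ball_subset_sc_dom: 
  assumes "n > 0" shows "ball 0 1 \<subseteq> sc_dom n"
proof
  fix w :: complex assume "w \<in> ball 0 1"
  then have "norm (w ^ (2 * n)) < 1" using assms by (simp add: norm_power power_less_one_iff)
  then have "\<bar>Re (w ^ (2 * n))\<bar> < 1" using abs_Re_le_cmod le_less_trans by blast
  then show "w \<in> sc_dom n" by (auto simp: sc_dom_def complex_nonpos_Reals_iff)
qed

text \<open>If t^(2n) w^(2n) were real and at most -1 with 0 <= t <= 1, then so would be w^(2n): the
  slits point away from the origin.\<close>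

lemma scaled_in_sc_dom:
  assumes n: "n > 0" and w: "w \<in> sc_dom n" and t: "0 \<le> t" "t \<le> 1"
  shows "complex_of_real t * w \<in> sc_dom n"
proof (rule ccontr)
  assume "complex_of_real t * w \<notin> sc_dom n"
  then have "1 + complex_of_real (t ^ (2*n)) * w ^ (2*n) \<in> \<real>\<^sub>\<le>\<^sub>0"
    by (simp add: sc_dom_def power_mult_distrib)
  then have *: "1 + t ^ (2*n) * Re (w ^ (2*n)) \<le> 0" "t ^ (2*n) * Im (w ^ (2*n)) = 0"
    unfolding complex_nonpos_Reals_iff by simp_all
  then have "t ^ (2*n) \<noteq> 0" by (metis add.right_neutral mult_zero_left not_one_le_zero)
  then have tt: "0 < t ^ (2*n)" "t ^ (2*n) \<le> 1" using t zero_le_power[of t "2*n"] power_le_one[of t "2*n"] by linarith+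
  have im: "Im (w ^ (2*n)) = 0" using *(2) tt(1) by (metis mult_eq_0_iff less_irrefl)
  have "Re (w ^ (2*n)) \<le> -1"
  proof (rule ccontr)
    assume "\<not> ?thesis"
    then have "t ^ (2*n) * Re (w ^ (2*n)) > t ^ (2*n) * (-1)" using tt by (intro mult_strict_left_mono) auto
    then show False using * tt by linarith
  qed
  then show False using im w by (simp add: sc_dom_def complex_nonpos_Reals_iff)
qed

lemma starlike_sc_dom: 
  assumes "n > 0" shows "starlike (sc_dom n)"
  unfolding starlike_def
proof (intro bexI ballI subsetI)
  show "0 \<in> sc_dom n" using ball_subset_sc_dom[OF assms] by auto
  fix x y assume "x \<in> sc_dom n" "y \<in> closed_segment 0 x"
  then show "y \<in> sc_dom n"
    using scaled_in_sc_dom[OF assms] by (auto simp: closed_segment_def scaleR_conv_of_real)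
qed

lemma holomorphic_sc_deriv: "sc_deriv n m s holomorphic_on sc_dom n"
  unfolding sc_deriv_def[abs_def] by (intro holomorphic_intros) (auto simp: sc_dom_def)

lemma integrable_inverse_sqrt: "(\<lambda>t::real. (1 - t) powr (-1/2)) integrable_on {0<..<1}"
proof -
  have "((\<lambda>t::real. (1 - t) powr (-1/2)) has_integral (- 2 * sqrt (1 - 1) - - 2 * sqrt (1 - 0))) {0..1}"
    by (rule fundamental_theorem_of_calculus_interior)
       (auto intro!: continuous_intros derivative_eq_intros
          simp: powr_minus powr_half_sqrt has_real_derivative_iff_has_vector_derivative[symmetric] field_simps)
  then show ?thesis using integrable_on_Icc_iff_Ioo by blast
qed

lemma powr_minus_le_inverse_sqrt:
  fixes s t x :: real
  assumes "0 < s" "s \<le> 1/2" "0 \<le> t" "t < 1" "1 - t \<le> x"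
  shows "x powr - s \<le> (1 - t) powr (-1/2)"
proof -
  have "x powr - s \<le> (1 - t) powr - s" using assms by (intro powr_mono2') auto
  also have "\<dots> \<le> (1 - t) powr (-1/2)" using assms by (intro powr_mono') auto
  finally show ?thesis .
qed

text \<open>The reverse triangle inequality with t^(2n) <= t gives |1 + (t w)^(2n)| >= 1 - t on the
  whole closed disc, so one majorant serves every \<open>w\<close>, every \<open>m\<close> and both
  exponents.\<close>

lemma sc_deriv_bound:
  assumes n: "n > 0" and s: "0 < s" "s \<le> 1/2" and w: "cmod w \<le> 1" and t: "t \<in> {0<..<1}"
  shows "norm (w * sc_deriv n m s (complex_of_real t * w)) \<le> (1 - t) powr (-1/2)"
proof -
  have tw: "cmod (complex_of_real t * w) \<le> t" using w t by (simp add: norm_mult mult_left_le)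
  have "cmod ((complex_of_real t * w) ^ (2*n)) \<le> t ^ (2*n)"
    unfolding norm_power using tw by (intro power_mono) auto
  also have "\<dots> \<le> t ^ 1" using t n by (intro power_decreasing) auto
  finally have "1 - t \<le> cmod (1 + (complex_of_real t * w) ^ (2*n))"
    using norm_triangle_ineq2[of 1 "- ((complex_of_real t * w) ^ (2*n))"] by simp
  then have "cmod (1 + (complex_of_real t * w) ^ (2*n)) powr - s \<le> (1 - t) powr (-1/2)"
    using s t by (intro powr_minus_le_inverse_sqrt) auto
  moreover have "cmod (w * (complex_of_real t * w) ^ (m - 1)) \<le> 1"
    unfolding norm_mult norm_power using w t tw
    by (intro mult_le_one power_le_one mult_le_one) (auto simp flip: norm_power)
  ultimately have "cmod (w * (complex_of_real t * w) ^ (m - 1)) * (cmod (1 + (complex_of_real t * w) ^ (2*n)) powr - s)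
    \<le> 1 * (1 - t) powr (-1/2)"
    by (intro mult_mono) auto
  then show ?thesis by (simp add: sc_deriv_def norm_mult norm_powr_real_powr' mult.assoc)
qed

lemma integrable_dominated_Ioo:
  fixes f :: "real \<Rightarrow> 'a::euclidean_space"
  assumes "continuous_on {0<..<1} f" "\<And>t. t \<in> {0<..<1} \<Longrightarrow> norm (f t) \<le> (1 - t) powr (-1/2)"
  shows "f integrable_on {0<..<1}"
  by (rule measurable_bounded_by_integrable_imp_integrable[OF _ integrable_inverse_sqrt])
     (use assms in \<open>auto intro!: continuous_imp_measurable_on_sets_lebesgue\<close>)

lemma sc_integrand_integrable:
  assumes n: "n > 0" and s: "0 < s" "s \<le> 1/2" and w: "cmod w \<le> 1"
  shows "(\<lambda>t. w * sc_deriv n m s (complex_of_real t * w)) integrable_on {0<..<1}"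
proof (rule integrable_dominated_Ioo)
  have "complex_of_real t * w \<in> sc_dom n" if "t \<in> {0<..<1}" for t
  proof -
    have "cmod (complex_of_real t * w) \<le> t" using w that by (simp add: norm_mult mult_left_le)
    then have "complex_of_real t * w \<in> ball 0 1" using that by simp
    then show ?thesis using ball_subset_sc_dom[OF n] by blast
  qed
  then have "continuous_on {0<..<1} (\<lambda>t. sc_deriv n m s (complex_of_real t * w))"
    by (intro continuous_on_compose2[OF holomorphic_on_imp_continuous_on[OF holomorphic_sc_deriv]])
       (auto intro!: continuous_intros)
  then show "continuous_on {0<..<1} (\<lambda>t. w * sc_deriv n m s (complex_of_real t * w))"
    by (intro continuous_intros)
qed (rule sc_deriv_bound[OF assms])

lemma continuous_on_sc_int:
  assumes n: "n > 0" and s: "0 < s" "s \<le> 1/2"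
  shows "continuous_on (cball 0 1) (sc_int n m s)"
  unfolding continuous_on_sequentially
proof (intro allI ballI impI, elim conjE)
  fix x a assume a: "a \<in> cball (0::complex) 1" and x: "\<forall>k. x k \<in> cball (0::complex) 1" and lim: "x \<longlonglongrightarrow> a"
  \<comment> \<open>The open interval avoids t = 1, where the ray may end at a vertex outside
    \<open>sc_dom\<close>.\<close>
  have "(\<lambda>k. integral {0<..<1} (\<lambda>t. x k * sc_deriv n m s (complex_of_real t * x k)))
      \<longlonglongrightarrow> integral {0<..<1} (\<lambda>t. a * sc_deriv n m s (complex_of_real t * a))"
  proof (rule dominated_convergence(2)[OF _ integrable_inverse_sqrt])
    fix k t
    show "(\<lambda>t. x k * sc_deriv n m s (complex_of_real t * x k)) integrable_on {0<..<1}"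
      using x by (intro sc_integrand_integrable n s) auto
    assume t: "t \<in> {0<..<1::real}"
    show "cmod (x k * sc_deriv n m s (complex_of_real t * x k)) \<le> (1 - t) powr (-1/2)"
      using x t by (intro sc_deriv_bound n s) auto
  next
    fix t :: real assume t: "t \<in> {0<..<1}"
    have "cmod (complex_of_real t * a) \<le> t" using a t by (simp add: norm_mult mult_left_le)
    then have "complex_of_real t * a \<in> ball 0 1" using t by simp
    then have "complex_of_real t * a \<in> sc_dom n" using ball_subset_sc_dom[OF n] by blast
    then have "isCont (sc_deriv n m s) (complex_of_real t * a)"
      using holomorphic_on_imp_continuous_on[OF holomorphic_sc_deriv] open_sc_dom
      by (auto simp: continuous_on_eq_continuous_at)
    then have "(\<lambda>k. sc_deriv n m s (complex_of_real t * x k)) \<longlonglongrightarrow> sc_deriv n m s (complex_of_real t * a)"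
      by (rule isCont_tendsto_compose) (intro tendsto_intros lim)
    then show "(\<lambda>k. x k * sc_deriv n m s (complex_of_real t * x k)) \<longlonglongrightarrow> a * sc_deriv n m s (complex_of_real t * a)"
      by (intro tendsto_intros lim)
  qed
  then show "(sc_int n m s \<circ> x) \<longlonglongrightarrow> sc_int n m s a"
    by (simp add: o_def sc_int_def integral_open_interval_real)
qed

text \<open>On the starlike domain a primitive G exists, and the ray integral equals G - G 0 by the
  fundamental theorem along the ray; no differentiation under the integral sign occurs.\<close>

lemma has_field_derivative_sc_int:
  assumes n: "n > 0" and w: "w \<in> sc_dom n"
  shows "(sc_int n m s has_field_derivative sc_deriv n m s w) (at w)"
proof -
  obtain G where G: "\<forall>x\<in>sc_dom n. (G has_field_derivative sc_deriv n m s x) (at x)"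
    using holomorphic_starlike_primitive[OF holomorphic_on_imp_continuous_on[OF holomorphic_sc_deriv]
      starlike_sc_dom[OF n] open_sc_dom finite.emptyI] holomorphic_sc_deriv open_sc_dom
    by (metis Diff_empty holomorphic_on_imp_differentiable_at)
  have eq: "sc_int n m s x = G x - G 0" if "x \<in> sc_dom n" for x
  proof -
    have "((\<lambda>t. x * sc_deriv n m s (complex_of_real t * x)) has_integral (G (0 + x * complex_of_real 1) - G (0 + x * complex_of_real 0))) {0..1}"
    proof (rule fundamental_theorem_of_calculus)
      fix t :: real assume t: "t \<in> {0..1}"
      have "complex_of_real t * x \<in> sc_dom n" using scaled_in_sc_dom[OF n that] t by auto
      then have "(G has_field_derivative sc_deriv n m s (complex_of_real t * x)) (at (0 + x * complex_of_real t) within UNIV)"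
        using G by (simp add: mult.commute)
      then show "((\<lambda>t. G (0 + x * complex_of_real t)) has_vector_derivative x * sc_deriv n m s (complex_of_real t * x)) (at t within {0..1})"
        by (rule has_vector_derivative_along_line) simp
    qed simp
    then have "sc_int n m s x = G (0 + x * complex_of_real 1) - G (0 + x * complex_of_real 0)"
      unfolding sc_int_def by (rule integral_unique)
    then show ?thesis by simp
  qed
  have "((\<lambda>x. G x - G 0) has_field_derivative sc_deriv n m s w) (at w)"
    using G w by (auto intro!: derivative_eq_intros)
  then show ?thesis
    by (rule has_field_derivative_transform_within_open[OF _ open_sc_dom w]) (simp add: eq)
qed

section \<open>Values of the ray integrals at side midpoints and vertices\<close>

lemma radial_base_ge:
  fixes c t :: real
  assumes "n > 0" "\<bar>c\<bar> \<le> 1" "t \<in> {0<..<1}"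
  shows "1 - t \<le> 1 + c * t ^ (2 * n)"
proof -
  have "t ^ (2*n) \<le> t ^ 1" using assms by (intro power_decreasing) auto
  moreover have "\<bar>c * t ^ (2*n)\<bar> \<le> 1 * t ^ (2*n)"
    unfolding abs_mult using assms by (intro mult_mono) auto
  ultimately show ?thesis by (simp add: abs_le_iff)
qed

lemma sc_radial_integrable:
  fixes c s :: real
  assumes n: "n > 0" and s: "0 < s" "s \<le> 1/2" and c: "\<bar>c\<bar> \<le> 1"
  shows "(\<lambda>t::real. t ^ (m - 1) * (1 + c * t ^ (2 * n)) powr - s) integrable_on {0..1}"
proof -
  have "(\<lambda>t::real. t ^ (m - 1) * (1 + c * t ^ (2 * n)) powr - s) integrable_on {0<..<1}"
  proof (rule integrable_dominated_Ioo)
    have "1 + c * t ^ (2 * n) \<noteq> 0" if "t \<in> {0<..<1}" for t using radial_base_ge[OF n c that] that by auto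
    then show "continuous_on {0<..<1} (\<lambda>t. t ^ (m - 1) * (1 + c * t ^ (2 * n)) powr - s)"
      by (intro continuous_intros) auto
    fix t :: real assume t: "t \<in> {0<..<1}"
    have "t ^ (m - 1) * (1 + c * t ^ (2 * n)) powr - s \<le> 1 * (1 - t) powr (-1/2)"
      using t s radial_base_ge[OF n c t] by (intro mult_mono powr_minus_le_inverse_sqrt power_le_one) auto
    then show "norm (t ^ (m - 1) * (1 + c * t ^ (2 * n)) powr - s) \<le> (1 - t) powr (-1/2)"
      using t by (simp add: abs_mult)
  qed
  then show ?thesis by (simp add: integrable_on_Icc_iff_Ioo)
qed

text \<open>The base is at most 2, so the integrand dominates t^(m-1) 2^(-s), whose integral is
  2^(-s)/m.\<close>

lemma sc_radial_pos:
  assumes n: "n > 0" and m: "m > 0" and s: "0 < s" "s \<le> 1/2" and c: "\<bar>c\<bar> \<le> 1"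
  shows "sc_radial n m s c > 0"
proof -
  have "((\<lambda>t::real. t ^ (m - 1) * 2 powr - s) has_integral (1 ^ m / real m * 2 powr - s - 0 ^ m / real m * 2 powr - s)) {0..1}"
    using m by (intro fundamental_theorem_of_calculus)
       (auto intro!: derivative_eq_intros simp: has_real_derivative_iff_has_vector_derivative[symmetric])
  then have I: "((\<lambda>t::real. t ^ (m - 1) * 2 powr - s) has_integral (2 powr - s / real m)) {0..1}"
    by (simp add: zero_power[OF m])
  have "2 powr - s / real m \<le> sc_radial n m s c"
    unfolding sc_radial_def
  proof (rule has_integral_le)
    \<comment> \<open>The comparison must skip t = 1: for c = -1 the base is 0 there, and
      \<open>0 powr - s\<close> is 0 by convention, below the minorant.\<close>
    show "((\<lambda>t::real. t ^ (m - 1) * 2 powr - s) has_integral (2 powr - s / real m)) {0<..<1}"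
      using I has_integral_Icc_iff_Ioo by blast
    show "((\<lambda>t. t ^ (m - 1) * (1 + c * t ^ (2 * n)) powr - s) has_integral
        integral {0..1} (\<lambda>t. t ^ (m - 1) * (1 + c * t ^ (2 * n)) powr - s)) {0<..<1}"
      using integrable_integral[OF sc_radial_integrable[OF n s c]] has_integral_Icc_iff_Ioo by blast
    fix t :: real assume t: "t \<in> {0<..<1}"
    have ct: "\<bar>c * t ^ (2*n)\<bar> \<le> 1" unfolding abs_mult power_abs using t c by (intro mult_le_one power_le_one) auto
    show "t ^ (m - 1) * 2 powr - s \<le> t ^ (m - 1) * (1 + c * t ^ (2 * n)) powr - s"
      using t s ct radial_base_ge[OF n c t] by (intro mult_left_mono powr_mono2') auto
  qed
  moreover have "0 < 2 powr - s / real m" using m by simp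
  ultimately show ?thesis by linarith
qed

text \<open>Along such a ray the base 1 + c t^(2n) is real and nonnegative, so the principal power
  is real and all phase sits in u^m. The end t = 1 at a vertex is consistent too: real and complex
  \<open>powr\<close> both vanish at base 0.\<close>

lemma sc_int_ray:
  assumes n: "n > 0" and m: "m > 0" and s: "0 < s" "s \<le> 1/2" and c: "\<bar>c\<bar> \<le> 1" and u: "u ^ (2 * n) = complex_of_real c"
  shows "sc_int n m s u = u ^ m * complex_of_real (sc_radial n m s c)"
proof -
  have "u * sc_deriv n m s (complex_of_real t * u) = u ^ m * complex_of_real (t ^ (m - 1) * (1 + c * t ^ (2 * n)) powr - s)"
    if t: "t \<in> {0..1}" for t
  proof -
    have "\<bar>c * t ^ (2*n)\<bar> \<le> 1" unfolding abs_mult power_abs using t c by (intro mult_le_one power_le_one) auto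
    then have "complex_of_real (1 + c * t ^ (2 * n)) powr complex_of_real (- s) = complex_of_real ((1 + c * t ^ (2 * n)) powr - s)"
      by (intro powr_of_real) auto
    moreover have "1 + (complex_of_real t * u) ^ (2 * n) = complex_of_real (1 + c * t ^ (2 * n))"
      by (simp add: power_mult_distrib u)
    ultimately have "sc_deriv n m s (complex_of_real t * u) =
        (complex_of_real t * u) ^ (m - 1) * complex_of_real ((1 + c * t ^ (2 * n)) powr - s)"
      by (simp only: sc_deriv_def of_real_minus)
    moreover have "u ^ m = u * u ^ (m - 1)" using m by (simp flip: power_Suc)
    ultimately show ?thesis by (simp add: power_mult_distrib)
  qed
  then have "sc_int n m s u = integral {0..1} (\<lambda>t. u ^ m * complex_of_real (t ^ (m - 1) * (1 + c * t ^ (2 * n)) powr - s))"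
    unfolding sc_int_def by (rule integral_cong)
  also have "\<dots> = u ^ m * integral {0..1} (\<lambda>t. complex_of_real (t ^ (m - 1) * (1 + c * t ^ (2 * n)) powr - s))"
    by simp
  also have "integral {0..1} (\<lambda>t. complex_of_real (t ^ (m - 1) * (1 + c * t ^ (2 * n)) powr - s)) = complex_of_real (sc_radial n m s c)"
    using integral_linear[OF sc_radial_integrable[OF n s c] bounded_linear_of_real]
    by (simp add: o_def sc_radial_def)
  finally show ?thesis .
qed

section \<open>The conformal map onto the polygon\<close>

lemma one_plus_cis: "1 + cis (2 * x) = complex_of_real (2 * cos x) * cis x"
  by (simp add: complex_eq_iff cos_double_cos sin_double power2_eq_square)

lemma powr_polar:
  assumes "r > 0" "\<bar>x\<bar> < pi"
  shows "(complex_of_real r * cis x) powr complex_of_real a = complex_of_real (r powr a) * cis (a * x)"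
proof -
  have e: "complex_of_real r * cis x = exp (Complex (ln r) x)"
    using assms by (simp add: exp_eq_polar exp_ln)
  have "Ln (complex_of_real r * cis x) = Complex (ln r) x"
    unfolding e using assms by (intro Ln_exp) auto
  then have "(complex_of_real r * cis x) powr complex_of_real a = exp (complex_of_real a * Complex (ln r) x)"
    using assms by (simp add: powr_def)
  also have "\<dots> = complex_of_real (r powr a) * cis (a * x)"
    using assms by (simp add: exp_eq_polar powr_def)
  finally show ?thesis .
qed

text \<open>The derivative is required only in the open interval because the arcs end at branch
  points.\<close>

lemma equal_ends_if_derivative_zero:
  fixes f :: "real \<Rightarrow> 'a::real_normed_vector"
  assumes "a \<le> b" "continuous_on {a..b} f"
    "\<And>x. x \<in> {a<..<b} \<Longrightarrow> (f has_vector_derivative 0) (at x)"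
  shows "f a = f b"
proof -
  have "((\<lambda>x. 0) has_integral (f b - f a)) {a..b}"
    using assms by (rule fundamental_theorem_of_calculus_interior)
  then show ?thesis using has_integral_unique[OF _ has_integral_0] by force
qed

lemma has_vector_derivative_along_arc:
  assumes "(F has_field_derivative D) (at (\<nu> * cis \<phi>))"
  shows "((\<lambda>\<phi>. F (\<nu> * cis \<phi>)) has_vector_derivative \<i> * (\<nu> * cis \<phi> * D)) (at \<phi>)"
proof -
  have "((\<lambda>\<phi>. \<nu> * cis \<phi>) has_vector_derivative \<i> * (\<nu> * cis \<phi>)) (at \<phi>)"
  proof -
    have "(exp has_field_derivative exp (\<i> * complex_of_real \<phi>)) (at (0 + \<i> * complex_of_real \<phi>) within UNIV)"
      by (auto intro!: derivative_eq_intros)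
    from has_vector_derivative_along_line[OF this]
    have "(cis has_vector_derivative \<i> * cis \<phi>) (at \<phi>)" by (simp add: cis_conv_exp[abs_def])
    then have "((\<lambda>\<phi>. \<nu> * cis \<phi>) has_vector_derivative \<nu> * (\<i> * cis \<phi>)) (at \<phi>)"
      by (rule has_vector_derivative_mult_right)
    then show ?thesis by (simp only: mult.left_commute[of \<nu>])
  qed
  from field_vector_diff_chain_at[OF this assms] show ?thesis by (simp add: o_def mult.assoc)
qed

text \<open>Meant for \<open>P\<close> the closed polygon and \<open>z\<close> possibly on its
  boundary. Since f (g y) = y on \<open>P\<close>, the quotient of \<open>g\<close> is the
  reciprocal of the quotient of \<open>f\<close> taken along g, and continuity of \<open>g\<close>
  lets the latter converge.\<close>

lemma has_field_derivative_inverse_within: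
  fixes f g :: "complex \<Rightarrow> complex"
  assumes f: "(f has_field_derivative D) (at w)" "D \<noteq> 0" "g z = w" "f w = z"
    and fg: "\<And>y. y \<in> P \<Longrightarrow> f (g y) = y" and g: "continuous (at z within P) g"
  shows "(g has_field_derivative 1 / D) (at z within P)"
proof -
  have ne: "g y \<noteq> w" if "y \<in> P" "y \<noteq> z" for y
    using fg[OF that(1)] f(4) that(2) by auto
  have "((\<lambda>x. (f x - f w) / (x - w)) \<longlongrightarrow> D) (at w)"
    using f(1) by (simp add: has_field_derivative_iff)
  moreover have "filterlim g (at w) (at z within P)"
  proof (rule filterlim_atI)
    show "(g \<longlongrightarrow> w) (at z within P)" using g by (simp add: continuous_within f)
    show "\<forall>\<^sub>F y in at z within P. g y \<noteq> w"
      using ne by (auto simp: eventually_at intro!: exI[of _ 1])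
  qed
  ultimately have "((\<lambda>y. (f (g y) - f w) / (g y - w)) \<longlongrightarrow> D) (at z within P)"
    by (rule filterlim_compose)
  then have "((\<lambda>y. inverse ((f (g y) - f w) / (g y - w))) \<longlongrightarrow> inverse D) (at z within P)"
    by (rule tendsto_inverse) (rule f)
  then have "((\<lambda>y. (g y - g z) / (y - z)) \<longlongrightarrow> 1 / D) (at z within P)"
    unfolding inverse_eq_divide[of D, symmetric]
    by (rule Lim_transform_eventually) (use fg f in \<open>auto simp: eventually_at intro!: exI[of _ 1]\<close>)
  then show ?thesis by (simp add: has_field_derivative_iff)
qed

text \<open>The divisor is the ray integral to a side midpoint, so the map fixes the points cis (pi
  l / n) and the inradius of the image is 1.\<close>

definition sc_map :: "nat \<Rightarrow> complex \<Rightarrow> complex" where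
  "sc_map n w = sc_int n 1 (1 / real n) w / complex_of_real (sc_radial n 1 (1 / real n) 1)"

definition sc_map_deriv :: "nat \<Rightarrow> complex \<Rightarrow> complex" where
  "sc_map_deriv n w = sc_deriv n 1 (1 / real n) w / complex_of_real (sc_radial n 1 (1 / real n) 1)"

context
  fixes n :: nat
  assumes n2: "n \<ge> 2"
begin

lemma n_pos: "n > 0" "0 < 1 / real n" "1 / real n \<le> 1/2"
  using n2 by (auto simp: field_simps)

lemma out_normal_power:
  "out_normal n l ^ (2 * n) = 1" "out_normal n l ^ n = (-1) ^ l"
proof -
  have "out_normal n l ^ n = cis (pi * real l)" using n_pos by (simp add: out_normal_def Complex.DeMoivre)
  also have "\<dots> = (cis pi) ^ l" by (simp add: Complex.DeMoivre mult.commute del: cis_pi)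
  finally show 1: "out_normal n l ^ n = (-1) ^ l" by simp
  show "out_normal n l ^ (2 * n) = 1"
    using 1 by (simp add: power_mult mult.commute[of 2] flip: power_mult_distrib) (simp flip: power_mult)
qed

lemma arc_base:
  assumes "\<bar>\<phi>\<bar> < pi / (2 * real n)"
  shows "cos (real n * \<phi>) > 0"
    "1 + (out_normal n l * cis \<phi>) ^ (2 * n) = complex_of_real (2 * cos (real n * \<phi>)) * cis (real n * \<phi>)"
    "out_normal n l * cis \<phi> \<in> sc_dom n"
proof -
  have a: "\<bar>real n * \<phi>\<bar> < pi / 2" using assms n_pos by (simp add: abs_mult field_simps)
  then show c: "cos (real n * \<phi>) > 0" by (intro cos_gt_zero_pi) auto
  show e: "1 + (out_normal n l * cis \<phi>) ^ (2 * n) = complex_of_real (2 * cos (real n * \<phi>)) * cis (real n * \<phi>)"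
  proof -
    have "(out_normal n l * cis \<phi>) ^ (2 * n) = cis (2 * (real n * \<phi>))"
      by (simp add: power_mult_distrib out_normal_power Complex.DeMoivre mult.assoc)
    then show ?thesis by (simp only: one_plus_cis)
  qed
  have "Re (1 + (out_normal n l * cis \<phi>) ^ (2 * n)) > 0"
    unfolding e using c by simp
  then show "out_normal n l * cis \<phi> \<in> sc_dom n"
    by (auto simp: sc_dom_def complex_nonpos_Reals_iff)
qed

text \<open>On an arc 1 + w^(2n) has modulus 2 cos (n phi) and argument n phi, within the principal
  range. The phase of w times the integrand thus rotates at rate m - s n: zero for the conformal
  map, and opposite for m and n - m when s = 1/2.\<close>

lemma arc_sc_deriv:
  assumes "\<bar>\<phi>\<bar> < pi / (2 * real n)" "m > 0"
  shows "out_normal n l * cis \<phi> * sc_deriv n m s (out_normal n l * cis \<phi>)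
    = out_normal n l ^ m * (complex_of_real ((2 * cos (real n * \<phi>)) powr - s) * cis ((real m - s * real n) * \<phi>))"
proof -
  have a: "\<bar>real n * \<phi>\<bar> < pi / 2" using assms n_pos by (simp add: abs_mult field_simps)
  have "(1 + (out_normal n l * cis \<phi>) ^ (2 * n)) powr complex_of_real (- s)
      = complex_of_real ((2 * cos (real n * \<phi>)) powr - s) * cis (- s * (real n * \<phi>))"
    unfolding arc_base(2)[OF assms(1)] using arc_base(1)[OF assms(1)] a by (intro powr_polar) auto
  moreover have "out_normal n l * cis \<phi> * (out_normal n l * cis \<phi>) ^ (m - 1) = out_normal n l ^ m * cis (real m * \<phi>)"
  proof -
    have "out_normal n l * cis \<phi> * (out_normal n l * cis \<phi>) ^ (m - 1) = (out_normal n l * cis \<phi>) ^ m"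
      using assms(2) by (simp flip: power_Suc)
    then show ?thesis by (simp add: power_mult_distrib Complex.DeMoivre)
  qed
  ultimately have "out_normal n l * cis \<phi> * sc_deriv n m s (out_normal n l * cis \<phi>) =
     out_normal n l ^ m * (complex_of_real ((2 * cos (real n * \<phi>)) powr - s) * (cis (real m * \<phi>) * cis (- s * (real n * \<phi>))))"
    unfolding sc_deriv_def of_real_minus by (simp only: mult.assoc[symmetric]) (simp only: mult_ac)
  then show ?thesis by (simp add: cis_mult algebra_simps)
qed

lemma vertex_power: "(out_normal n l * cis (pi / (2 * real n))) ^ (2 * n) = -1"
  "(out_normal n l * cis (- (pi / (2 * real n)))) ^ (2 * n) = -1"
  using n_pos by (simp_all add: power_mult_distrib out_normal_power Complex.DeMoivre complex_eq_iff)

lemma arc_point_in_cball: "out_normal n l * cis \<phi> \<in> cball 0 1"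
  by (simp add: norm_mult)

lemma sc_const_pos: "0 < sc_radial n 1 (1 / real n) 1"
  using n_pos by (intro sc_radial_pos) auto

lemma continuous_on_sc_map: "continuous_on (cball 0 1) (sc_map n)"
  unfolding sc_map_def[abs_def] using sc_const_pos n_pos
  by (intro continuous_intros continuous_on_sc_int) auto

lemma has_field_derivative_sc_map:
  "w \<in> sc_dom n \<Longrightarrow> (sc_map n has_field_derivative sc_map_deriv n w) (at w)"
  unfolding sc_map_def[abs_def] sc_map_deriv_def
  using n_pos by (intro DERIV_cdivide has_field_derivative_sc_int) auto

lemma sc_map_deriv_nonzero: "w \<in> sc_dom n \<Longrightarrow> sc_map_deriv n w \<noteq> 0"
  using sc_const_pos by (auto simp: sc_map_deriv_def sc_deriv_def sc_dom_def)

text \<open>The phase rate 1 - (1/n) n vanishes, so the image of the arc moves straight along its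
  side with positive speed, and the radial direction goes to the outward normal.\<close>

lemma arc_sc_map_deriv:
  assumes "\<bar>\<phi>\<bar> < pi / (2 * real n)"
  shows "\<exists>\<rho>>0. out_normal n l * cis \<phi> * sc_map_deriv n (out_normal n l * cis \<phi>) = out_normal n l * complex_of_real \<rho>"
proof (intro exI conjI)
  show "0 < (2 * cos (real n * \<phi>)) powr - (1 / real n) / sc_radial n 1 (1 / real n) 1"
    using arc_base(1)[OF assms] sc_const_pos by simp
  show "out_normal n l * cis \<phi> * sc_map_deriv n (out_normal n l * cis \<phi>) =
      out_normal n l * complex_of_real ((2 * cos (real n * \<phi>)) powr - (1 / real n) / sc_radial n 1 (1 / real n) 1)"
    using arc_sc_deriv[OF assms, of 1 l "1 / real n"] n_pos by (simp add: sc_map_deriv_def)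
qed

lemma continuous_on_arc:
  assumes "continuous_on (cball 0 1) F"
  shows "continuous_on A (\<lambda>\<phi>. F (out_normal n l * cis \<phi>))"
  by (rule continuous_on_compose2[OF assms])
     (use arc_point_in_cball in \<open>auto intro!: continuous_intros simp: cis_conv_exp\<close>)

text \<open>\<open>G\<close> rotates the arc of side \<open>l\<close> to the standard position. Its
  real part is constant, equal to 1 as read off at the midpoint, and its imaginary part increases.
  At the ends \<open>G\<close> is cis (+-a) R/K; lying on the line Re = 1 forces R/K = 1/cos a, so
  the side length comes out without evaluating either integral.\<close>

lemma sc_map_arc:
  shows "\<bar>\<phi>\<bar> \<le> pi / (2 * real n) \<Longrightarrow> \<exists>y. \<bar>y\<bar> \<le> tan (pi / (2 * real n)) \<and> sc_map n (out_normal n l * cis \<phi>) = side_pt n l y"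
    "\<bar>y\<bar> \<le> tan (pi / (2 * real n)) \<Longrightarrow> \<exists>\<phi>. \<bar>\<phi>\<bar> \<le> pi / (2 * real n) \<and> sc_map n (out_normal n l * cis \<phi>) = side_pt n l y"
    "sc_map n (out_normal n l * cis (pi / (2 * real n))) = side_b n l"
    "sc_map n (out_normal n l * cis (- (pi / (2 * real n)))) = side_a n l"
proof -
  define \<nu> where "\<nu> = out_normal n l"
  define a where "a = pi / (2 * real n)"
  define K where "K = sc_radial n 1 (1 / real n) 1"
  define R where "R = sc_radial n 1 (1 / real n) (-1)"
  define G where "G = (\<lambda>\<phi>. cnj \<nu> * sc_map n (\<nu> * cis \<phi>))"
  have a: "a > 0" using half_angle[OF n2] by (simp add: a_def)
  have c: "cos a > 0" using cos_half_angle_pos[OF n2] by (simp add: a_def)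
  have K: "K > 0" using sc_const_pos by (simp add: K_def)
  have contG: "continuous_on A G" for A
    unfolding G_def \<nu>_def by (intro continuous_intros continuous_on_arc continuous_on_sc_map)
  have derG: "\<exists>\<rho>>0. (G has_vector_derivative \<i> * complex_of_real \<rho>) (at \<phi>)" if \<phi>: "\<bar>\<phi>\<bar> < a" for \<phi>
  proof -
    obtain \<rho> where \<rho>: "\<rho> > 0" "\<nu> * cis \<phi> * sc_map_deriv n (\<nu> * cis \<phi>) = \<nu> * complex_of_real \<rho>"
      using arc_sc_map_deriv[of \<phi> l] \<phi> unfolding \<nu>_def a_def by blast
    have "((\<lambda>\<phi>. sc_map n (\<nu> * cis \<phi>)) has_vector_derivative \<i> * (\<nu> * cis \<phi> * sc_map_deriv n (\<nu> * cis \<phi>))) (at \<phi>)"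
      using \<phi> unfolding \<nu>_def a_def
      by (intro has_vector_derivative_along_arc has_field_derivative_sc_map arc_base(3))
    then have "(G has_vector_derivative cnj \<nu> * (\<i> * (\<nu> * complex_of_real \<rho>))) (at \<phi>)"
      unfolding G_def \<rho>(2) by (rule has_vector_derivative_mult_right)
    moreover have "cnj \<nu> * (\<i> * (\<nu> * complex_of_real \<rho>)) = \<i> * complex_of_real \<rho>"
      by (simp only: mult.left_commute[of "cnj \<nu>" \<i>]) (simp add: \<nu>_def)
    ultimately show ?thesis using \<rho>(1) by auto
  qed
  have ReG: "Re (G x) = Re (G y)" if xy: "-a \<le> x" "x \<le> y" "y \<le> a" for x y
  proof (rule equal_ends_if_derivative_zero[of x y "\<lambda>\<phi>. Re (G \<phi>)"])
    fix u assume "u \<in> {x<..<y}"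
    then have "\<bar>u\<bar> < a" using xy by auto
    then obtain \<rho> where "(G has_vector_derivative \<i> * complex_of_real \<rho>) (at u)" using derG[of u] by auto
    from has_real_derivative_Re[OF this] show "((\<lambda>\<phi>. Re (G \<phi>)) has_vector_derivative 0) (at u)"
      by (simp add: has_real_derivative_iff_has_vector_derivative)
  qed (use that in \<open>auto intro!: continuous_intros contG\<close>)
  have ImG: "Im (G x) < Im (G y)" if xy: "-a \<le> x" "x < y" "y \<le> a" for x y
  proof (rule DERIV_pos_imp_increasing_open[OF that(2)])
    fix u assume "x < u" "u < y"
    then have "\<bar>u\<bar> < a" using xy by auto
    then obtain \<rho> where "\<rho> > 0" "(G has_vector_derivative \<i> * complex_of_real \<rho>) (at u)" using derG[of u] by auto
    with has_real_derivative_Im[OF this(2)] show "\<exists>d. ((\<lambda>\<phi>. Im (G \<phi>)) has_real_derivative d) (at u) \<and> d > 0"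
      by auto
  qed (auto intro!: continuous_intros contG)
  have "sc_int n 1 (1 / real n) \<nu> = \<nu> * complex_of_real K"
    using sc_int_ray[of n 1 "1 / real n" 1 \<nu>] n_pos out_normal_power[of l] by (simp add: \<nu>_def K_def)
  then have "sc_map n \<nu> = \<nu>" unfolding sc_map_def K_def[symmetric] using K by simp
  then have "G 0 = 1" by (simp add: G_def) (simp add: \<nu>_def)
  then have Re1: "Re (G x) = 1" if "\<bar>x\<bar> \<le> a" for x
    using ReG[of x 0] ReG[of 0 x] that by (cases "x \<ge> 0") auto
  have ends: "G a = cis a * complex_of_real (R / K)" "G (-a) = cis (-a) * complex_of_real (R / K)"
  proof -
    have "sc_int n 1 (1 / real n) (\<nu> * cis a) = \<nu> * cis a * complex_of_real R"
      "sc_int n 1 (1 / real n) (\<nu> * cis (-a)) = \<nu> * cis (-a) * complex_of_real R"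
      using sc_int_ray[of n 1 "1 / real n" "-1"] n_pos vertex_power[of l] by (simp_all add: \<nu>_def R_def a_def)
    then show "G a = cis a * complex_of_real (R / K)" "G (-a) = cis (-a) * complex_of_real (R / K)"
      unfolding G_def sc_map_def K_def[symmetric] by (simp_all add: \<nu>_def mult.assoc)
  qed
  have "Re (G a) = cos a * (R / K)" unfolding ends(1) by (simp del: of_real_divide)
  moreover have "Re (G a) = 1" using Re1[of a] a by simp
  ultimately have RK: "cos a * (R / K) = 1" by (simp only:)
  have "sin a * (R / K) = tan a" using RK c by (auto simp: tan_def field_simps)
  then have ImE: "Im (G a) = tan a" "Im (G (-a)) = - tan a"
    unfolding ends by (simp_all del: of_real_divide)
  have arcG: "sc_map n (\<nu> * cis x) = side_pt n l (Im (G x))" if "\<bar>x\<bar> \<le> a" for x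
  proof -
    have "sc_map n (\<nu> * cis x) = \<nu> * G x" by (simp add: G_def \<nu>_def mult.assoc[symmetric])
    also have "G x = Complex 1 (Im (G x))" using Re1[OF that] by (simp add: complex_eq_iff)
    finally show ?thesis unfolding side_pt_def \<nu>_def .
  qed
  show "\<exists>y. \<bar>y\<bar> \<le> tan (pi / (2 * real n)) \<and> sc_map n (out_normal n l * cis \<phi>) = side_pt n l y"
    if "\<bar>\<phi>\<bar> \<le> pi / (2 * real n)"
  proof -
    have \<phi>: "\<bar>\<phi>\<bar> \<le> a" using that by (simp add: a_def)
    then have \<phi>': "- a \<le> \<phi>" "\<phi> \<le> a" by auto
    have "Im (G \<phi>) \<le> Im (G a)" using ImG[of \<phi> a] \<phi>' by (cases "\<phi> = a") auto
    moreover have "Im (G (-a)) \<le> Im (G \<phi>)" using ImG[of "-a" \<phi>] \<phi>' by (cases "\<phi> = -a") auto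
    ultimately show ?thesis using arcG[OF \<phi>] ImE unfolding a_def \<nu>_def by (intro exI[of _ "Im (G \<phi>)"]) auto
  qed
  show "\<exists>\<phi>. \<bar>\<phi>\<bar> \<le> pi / (2 * real n) \<and> sc_map n (out_normal n l * cis \<phi>) = side_pt n l y"
    if "\<bar>y\<bar> \<le> tan (pi / (2 * real n))"
  proof -
    have "\<exists>x\<ge>-a. x \<le> a \<and> Im (G x) = y"
      using that a by (intro IVT') (auto simp: ImE a_def[symmetric] intro!: continuous_intros contG)
    then obtain x where x: "-a \<le> x" "x \<le> a" "Im (G x) = y" by blast
    then have "\<bar>x\<bar> \<le> a" by auto
    with arcG[OF this] x(3) show ?thesis unfolding a_def \<nu>_def by blast
  qed
  show "sc_map n (out_normal n l * cis (pi / (2 * real n))) = side_b n l"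
    "sc_map n (out_normal n l * cis (- (pi / (2 * real n)))) = side_a n l"
    using arcG[of a] arcG[of "-a"] a ImE by (simp_all add: side_ends[OF n2] a_def \<nu>_def)
qed

section \<open>Bijectivity from the closed disc onto the polygon\<close>

lemma sc_map_sphere:
  assumes "cmod w = 1"
  obtains l where "l \<in> {1..2*n}" "sc_map n w \<in> closed_segment (side_a n l) (side_b n l)"
proof -
  obtain m \<phi> where m: "m \<in> {1..2*n}" "\<bar>\<phi>\<bar> \<le> pi / (2 * real n)" "w = out_normal n m * cis \<phi>"
    using polar_sector[of n w] n_pos assms by auto
  then obtain y where "\<bar>y\<bar> \<le> tan (pi / (2 * real n))" "sc_map n w = side_pt n m y"
    using sc_map_arc(1) by blast
  then show ?thesis using m that[of m] unfolding closed_side[OF n2] by (auto simp: abs_le_iff)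
qed

text \<open>Each half-plane inequality bounds the real part of a holomorphic function and holds on
  the circle, so the maximum principle carries it inside.\<close>

lemma sc_map_in_polygon:
  assumes "cmod w \<le> 1" shows "sc_map n w \<in> polygon n"
proof -
  have "Re (cnj (out_normal n l) * sc_map n w) \<le> 1" if l: "l \<in> {1..2*n}" for l
  proof (rule maximum_real_frontier[of "\<lambda>w. cnj (out_normal n l) * sc_map n w" "cball 0 1"])
    have "sc_map n holomorphic_on ball 0 1"
      using ball_subset_sc_dom[OF n_pos(1)] has_field_derivative_sc_map
      by (auto simp: holomorphic_on_open)
    then show "(\<lambda>w. cnj (out_normal n l) * sc_map n w) holomorphic_on interior (cball 0 1)"
      by (auto intro!: holomorphic_intros)
    show "continuous_on (closure (cball 0 1)) (\<lambda>w. cnj (out_normal n l) * sc_map n w)"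
      by (auto intro!: continuous_intros continuous_on_sc_map)
    fix z :: complex assume "z \<in> frontier (cball 0 1)"
    then have "cmod z = 1" by simp
    then obtain k where "k \<in> {1..2*n}" "sc_map n z \<in> closed_segment (side_a n k) (side_b n k)"
      by (rule sc_map_sphere)
    then have "sc_map n z \<in> polygon n" using closed_side_subset[OF n2] by blast
    then show "Re (cnj (out_normal n l) * sc_map n z) \<le> 1"
      using l unfolding polygon_eq_halfplanes[OF n2] by blast
  qed (use assms in auto)
  then show ?thesis unfolding polygon_eq_halfplanes[OF n2] by blast
qed

text \<open>1 + w^(2n) lies in the right half-plane, and the power -1/n only shrinks its argument in
  absolute value.\<close>

lemma Re_sc_map_deriv_pos:
  assumes "w \<in> ball 0 1" shows "Re (sc_map_deriv n w) > 0"
proof -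
  define u where "u = 1 + w ^ (2 * n)"
  have "norm (w ^ (2 * n)) < 1" using assms n_pos by (simp add: norm_power power_less_one_iff)
  then have "\<bar>Re (w ^ (2 * n))\<bar> < 1" using abs_Re_le_cmod le_less_trans by blast
  then have u: "Re u > 0" by (simp add: u_def)
  then have u0: "u \<noteq> 0" by auto
  have im: "\<bar>Im (Ln u)\<bar> < pi / 2" using Re_Ln_pos_lt[OF u0] u by simp
  have "1 / real n * \<bar>Im (Ln u)\<bar> \<le> 1 * \<bar>Im (Ln u)\<bar>" using n_pos by (intro mult_right_mono) auto
  moreover have "\<bar>1 / real n * Im (Ln u)\<bar> = 1 / real n * \<bar>Im (Ln u)\<bar>" using n_pos by (simp add: abs_mult)
  ultimately have "\<bar>1 / real n * Im (Ln u)\<bar> < pi / 2" using im by linarith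
  then have "cos (1 / real n * Im (Ln u)) > 0" by (intro cos_gt_zero_pi) linarith+
  then have "Re (u powr - complex_of_real (1 / real n)) > 0"
    using u0 by (simp add: powr_def Re_exp)
  then show ?thesis using sc_const_pos by (simp add: sc_map_deriv_def sc_deriv_def u_def)
qed

text \<open>Noshiro--Warschawski: on a convex set, positivity of \<open>Re f'\<close> forces injectivity.\<close>

lemma inj_on_sc_map: "inj_on (sc_map n) (cball 0 1)"
proof (rule inj_onI, rule ccontr)
  fix a b assume a: "a \<in> cball (0::complex) 1" and b: "b \<in> cball (0::complex) 1"
    and eq: "sc_map n a = sc_map n b" and ne: "a \<noteq> b"
  define d where "d = b - a"
  have d: "d \<noteq> 0" using ne by (simp add: d_def)
  have lin: "a + d * complex_of_real t = (1 - t) *\<^sub>R a + t *\<^sub>R b" for t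
    by (simp add: d_def scaleR_conv_of_real algebra_simps)
  \<comment> \<open>The disc is strictly convex: even if both ends are on the circle, the open chord
    is in the open disc, where the derivative is controlled.\<close>
  have inball: "a + d * complex_of_real t \<in> ball 0 1" if "0 < t" "t < 1" for t
  proof -
    have "a + d * complex_of_real t \<in> open_segment a b"
      unfolding lin using that ne by (auto simp: in_segment)
    then show ?thesis using dist_decreases_open_segment[of _ a b 0] a b by fastforce
  qed
  have incball: "a + d * complex_of_real t \<in> cball 0 1" if "t \<in> {0..1}" for t
    unfolding lin using that a b by (intro convexD[OF convex_cball]) auto
  \<comment> \<open>Division by the chord direction \<open>d\<close> cancels the factor produced by
    differentiating along the chord, leaving Re of the complex derivative itself.\<close>
  have "Re (sc_map n (a + d * complex_of_real 0) / d) < Re (sc_map n (a + d * complex_of_real 1) / d)"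
  proof (rule DERIV_pos_imp_increasing_open[of 0 1 "\<lambda>t. Re (sc_map n (a + d * complex_of_real t) / d)"])
    fix t :: real assume t: "0 < t" "t < 1"
    define z where "z = a + d * complex_of_real t"
    have z: "z \<in> ball 0 1" using inball[OF t] by (simp add: z_def)
    then have "z \<in> sc_dom n" using ball_subset_sc_dom[OF n_pos(1)] by blast
    from has_field_derivative_sc_map[OF this]
    have "((\<lambda>w. sc_map n w / d) has_field_derivative sc_map_deriv n z / d) (at (a + d * complex_of_real t) within UNIV)"
      unfolding z_def by (intro DERIV_cdivide) auto
    from has_real_derivative_Re[OF has_vector_derivative_along_line[OF this]]
    have "((\<lambda>t. Re (sc_map n (a + d * complex_of_real t) / d)) has_real_derivative Re (sc_map_deriv n z)) (at t)"
      using d by simp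
    then show "\<exists>y. ((\<lambda>t. Re (sc_map n (a + d * complex_of_real t) / d)) has_real_derivative y) (at t) \<and> y > 0"
      using Re_sc_map_deriv_pos[OF z] by blast
  next
    have "continuous_on {0..1} (\<lambda>t. sc_map n (a + d * complex_of_real t))"
      by (rule continuous_on_compose2[OF continuous_on_sc_map]) (use incball in \<open>auto intro!: continuous_intros\<close>)
    then show "continuous_on {0..1} (\<lambda>t. Re (sc_map n (a + d * complex_of_real t) / d))"
      using d by (intro continuous_intros) auto
  qed simp
  then show False using eq by (simp add: d_def)
qed

text \<open>The image is open by invariance of domain, and relatively closed in the interior because
  the circle is sent to the sides, which miss the interior. Connectedness of the interior
  finishes.\<close>

lemma sc_map_image_ball: "sc_map n ` ball 0 1 = interior (polygon n)"
proof -
  let ?I = "interior (polygon n)"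
  have opn: "open (sc_map n ` ball 0 1)"
    by (intro invariance_of_domain continuous_on_subset[OF continuous_on_sc_map] inj_on_subset[OF inj_on_sc_map]) auto
  moreover have "sc_map n ` ball 0 1 \<subseteq> polygon n" using sc_map_in_polygon by force
  ultimately have sub: "sc_map n ` ball 0 1 \<subseteq> ?I" by (simp add: interior_maximal)
  have sphere: "sc_map n w \<notin> ?I" if w: "cmod w = 1" for w
  proof
    assume I: "sc_map n w \<in> ?I"
    obtain l where l: "l \<in> {1..2*n}" "sc_map n w \<in> closed_segment (side_a n l) (side_b n l)"
      using sc_map_sphere[OF w] by blast
    then obtain y where "sc_map n w = side_pt n l y" unfolding closed_side[OF n2] by blast
    then have "Re (cnj (out_normal n l) * sc_map n w) = 1" using Re_side_pt[OF n2] by simp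
    then show False using interior_polygon_halfplane[OF n2 I l(1)] by simp
  qed
  have eq: "sc_map n ` ball 0 1 = ?I \<inter> sc_map n ` cball 0 1"
  proof
    show "?I \<inter> sc_map n ` cball 0 1 \<subseteq> sc_map n ` ball 0 1"
      using sphere by (force simp: le_less)
  qed (use sub in auto)
  have "closed (sc_map n ` cball 0 1)"
    by (intro compact_imp_closed compact_continuous_image continuous_on_sc_map compact_cball)
  then have "closedin (top_of_set ?I) (sc_map n ` ball 0 1)"
    unfolding eq by (rule closedin_closed_Int)
  moreover have "openin (top_of_set ?I) (sc_map n ` ball 0 1)"
    using opn sub by (simp add: open_subset)
  moreover have "connected ?I"
    by (intro convex_connected convex_interior convex_polygon[OF n2])
  moreover have "sc_map n ` ball 0 1 \<noteq> {}" by simp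
  ultimately show ?thesis unfolding connected_clopen by blast
qed

lemma sc_map_image_cball: "sc_map n ` cball 0 1 = polygon n"
proof
  show "sc_map n ` cball 0 1 \<subseteq> polygon n" using sc_map_in_polygon by auto
  have "polygon n \<subseteq> closure (interior (polygon n))"
    using sc_map_image_ball convex_closure_interior[OF convex_polygon[OF n2]] closure_subset by fastforce
  also have "\<dots> \<subseteq> sc_map n ` cball 0 1"
  proof (rule closure_minimal)
    show "closed (sc_map n ` cball 0 1)"
      by (intro compact_imp_closed compact_continuous_image continuous_on_sc_map compact_cball)
  qed (use sc_map_image_ball in force)
  finally show "polygon n \<subseteq> sc_map n ` cball 0 1" .
qed

lemma sc_map_homeomorphism:
  obtains g where "homeomorphism (cball 0 1) (polygon n) (sc_map n) g"
  using homeomorphism_compact[OF compact_cball continuous_on_sc_map sc_map_image_cball inj_on_sc_map] by blast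

end

section \<open>The potential\<close>

text \<open>The sum starts at m = 1, since the modes exclude the constant; the -1 is the missing
  term m = 0.\<close>

lemma sum_cis_even:
  fixes x :: int
  assumes "n > 0" "\<bar>x\<bar> < int n"
  shows "(\<Sum>m\<in>{1..<n}. cis (2 * pi * real m * real_of_int x / real n)) = (if x = 0 then of_nat n else 0) - 1"
proof -
  define q where "q = cis (2 * pi * real_of_int x / real n)"
  have q: "cis (2 * pi * real m * real_of_int x / real n) = q ^ m" for m
    by (simp add: q_def Complex.DeMoivre mult_ac)
  have "(\<Sum>m<n. q ^ m) = (if x = 0 then of_nat n else 0)"
  proof (cases "x = 0")
    case False
    have "q \<noteq> 1"
    proof
      assume "q = 1"
      then have "cos (2 * pi * real_of_int x / real n) = 1" by (simp add: q_def complex_eq_iff)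
      then obtain i :: int where "2 * pi * real_of_int x / real n = real_of_int i * 2 * pi"
        unfolding cos_one_2pi_int by auto
      then have "real_of_int x = real_of_int (i * int n)" using assms by (simp add: field_simps)
      then have "x = i * int n" by (simp only: of_int_eq_iff)
      then show False using False assms by (simp add: abs_mult)
    qed
    moreover have "q ^ n = 1"
      using assms by (simp add: q_def Complex.DeMoivre cis_multiple_2pi)
    ultimately show ?thesis using False by (simp add: geometric_sum)
  qed (simp add: q_def)
  moreover have "{..<n} = insert 0 {1..<n}" using assms by auto
  ultimately show ?thesis unfolding q by (simp add: algebra_simps)
qed

text \<open>For odd \<open>y\<close> the ratio q satisfies q^n = -1, so the geometric sum without
  its first term is (1 + q)/(1 - q), the half-angle form of i cot. Being purely imaginary, it
  contributes to currents and not to voltages.\<close>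

lemma sum_cis_odd:
  fixes y :: int
  assumes "n > 0" "odd y"
  shows "(\<Sum>m\<in>{1..<n}. cis (pi * real m * real_of_int y / real n)) = \<i> * complex_of_real (cot (pi * real_of_int y / (2 * real n)))"
proof -
  define b where "b = pi * real_of_int y / (2 * real n)"
  define q where "q = cis (2 * b)"
  have q: "cis (pi * real m * real_of_int y / real n) = q ^ m" for m
    by (simp add: q_def b_def Complex.DeMoivre mult_ac)
  have s: "sin b \<noteq> 0"
  proof
    assume "sin b = 0"
    then obtain i :: int where "b = real_of_int i * pi" unfolding sin_zero_iff_int2 by auto
    then have "real_of_int y = real_of_int (2 * int n * i)" using assms by (simp add: b_def field_simps)
    then have "y = 2 * int n * i" by (simp only: of_int_eq_iff)
    then show False using assms by simp
  qed
  have q1: "q - 1 = 2 * \<i> * complex_of_real (sin b) * cis b"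
    by (simp add: q_def complex_eq_iff cos_double_sin sin_double power2_eq_square)
  have q2: "q + 1 = 2 * complex_of_real (cos b) * cis b"
    using one_plus_cis[of b] by (simp add: q_def add.commute)
  have qn: "q ^ n = -1"
  proof -
    have "q ^ n = cis (pi * real_of_int y)" using assms by (simp add: q_def b_def Complex.DeMoivre)
    then show ?thesis using assms by (simp add: complex_eq_iff cos_int_times_real sin_int_times_real)
  qed
  have ne: "q - 1 \<noteq> 0" unfolding q1 using s by simp
  then have "(\<Sum>m<n. q ^ m) = - 2 / (q - 1)" by (simp add: geometric_sum qn)
  moreover have "{..<n} = insert 0 {1..<n}" using assms by auto
  ultimately have "(\<Sum>m\<in>{1..<n}. q ^ m) = - 2 / (q - 1) - 1" by (simp add: algebra_simps)
  also have "\<dots> = - (q + 1) / (q - 1)" using ne by (simp add: field_simps)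
  also have "\<dots> = \<i> * complex_of_real (cot b)"
    unfolding q1 q2 using s by (simp add: cot_def field_simps)
  finally show ?thesis unfolding q b_def .
qed

text \<open>A vertical derivative multiplies the complex derivative by i, so the two pure second
  derivatives are Re F'' and Re (i^2 F'').\<close>

lemma harmonic_on_Re:
  assumes "open S" "F holomorphic_on S"
  shows "harmonic_on S (\<lambda>z. Re (F z) + c)"
proof -
  define F1 where "F1 = deriv F"
  define F2 where "F2 = deriv F1"
  have hol: "F1 holomorphic_on S" "F2 holomorphic_on S"
    unfolding F1_def F2_def using assms by (auto intro: holomorphic_deriv)
  have D: "(F has_field_derivative F1 z) (at z)" "(F1 has_field_derivative F2 z) (at z)" if "z \<in> S" for z
    unfolding F1_def F2_def using that assms hol(1)[unfolded F1_def] by (auto intro: holomorphic_derivI)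
  have line: "((\<lambda>t. Re (e * G (z + d * complex_of_real t))) has_real_derivative Re (e * (d * G'))) (at 0)"
    if "(G has_field_derivative G') (at z)" for G G' e d z
  proof -
    have "(G has_field_derivative G') (at (z + d * complex_of_real 0) within UNIV)" using that by simp
    from has_vector_derivative_along_line[OF this]
    have "((\<lambda>t. G (z + d * complex_of_real t)) has_vector_derivative d * G') (at 0)" by simp
    from has_real_derivative_Re[OF has_vector_derivative_mult_right[OF this]] show ?thesis .
  qed
  have line1: "((\<lambda>t. Re (e * G (z + complex_of_real t))) has_real_derivative Re (e * G')) (at 0)"
    if "(G has_field_derivative G') (at z)" for G G' e z
    using line[OF that, of e 1] by simp
  have c: "continuous_on S F1" "continuous_on S F2"
    using hol holomorphic_on_imp_continuous_on by auto
  have "harmonic_partials S (\<lambda>z. Re (1 * F z) + c) (\<lambda>z. Re (1 * F1 z)) (\<lambda>z. Re (\<i> * F1 z))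
      (\<lambda>z. Re (1 * F2 z)) (\<lambda>z. Re (1 * (\<i> * F2 z))) (\<lambda>z. Re (\<i> * F2 z)) (\<lambda>z. Re (\<i> * (\<i> * F2 z)))"
    unfolding harmonic_partials_def
  proof (intro conjI ballI)
    fix z assume z: "z \<in> S"
    note D = D[OF z]
    show "((\<lambda>t. Re (1 * F (z + complex_of_real t)) + c) has_real_derivative Re (1 * F1 z)) (at 0)"
      using DERIV_add[OF line1[OF D(1), of 1] DERIV_const[of c]] by simp
    show "((\<lambda>t. Re (1 * F (z + \<i> * complex_of_real t)) + c) has_real_derivative Re (\<i> * F1 z)) (at 0)"
      using DERIV_add[OF line[OF D(1), of 1 \<i>] DERIV_const[of c]] by simp
    show "((\<lambda>t. Re (1 * F1 (z + complex_of_real t))) has_real_derivative Re (1 * F2 z)) (at 0)"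
      by (rule line1[OF D(2)])
    show "((\<lambda>t. Re (1 * F1 (z + \<i> * complex_of_real t))) has_real_derivative Re (1 * (\<i> * F2 z))) (at 0)"
      by (rule line[OF D(2)])
    show "((\<lambda>t. Re (\<i> * F1 (z + complex_of_real t))) has_real_derivative Re (\<i> * F2 z)) (at 0)"
      by (rule line1[OF D(2)])
    show "((\<lambda>t. Re (\<i> * F1 (z + \<i> * complex_of_real t))) has_real_derivative Re (\<i> * (\<i> * F2 z))) (at 0)"
      by (rule line[OF D(2)])
  qed (auto intro!: continuous_intros c)
  then show ?thesis unfolding harmonic_on_iff_partials mult_1_left using assms(1) by blast
qed

text \<open>The phase is the Fourier coefficient of the unit voltage at node \<open>k\<close>.
  Division by \<open>sc_radial\<close> cancels the ray integral at the vertices, and the factor 2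
  cos (m a) with a = pi/(2n) is chosen because 2 cos (m a) cis (+-m a) = 1 + cis (+-2 m a): one
  summand yields the voltage, the other the current.\<close>

definition pot_coeff :: "nat \<Rightarrow> nat \<Rightarrow> nat \<Rightarrow> complex" where
  "pot_coeff n k m = complex_of_real (2 * cos (real m * (pi / (2 * real n))) / (real n * sc_radial n m (1/2) (-1)))
     * cis (- (2 * pi * real m * real k / real n))"

definition pot :: "nat \<Rightarrow> nat \<Rightarrow> complex \<Rightarrow> complex" where
  "pot n k w = (\<Sum>m\<in>{1..<n}. pot_coeff n k m * sc_int n m (1/2) w)"

definition pot_deriv :: "nat \<Rightarrow> nat \<Rightarrow> complex \<Rightarrow> complex" where
  "pot_deriv n k w = (\<Sum>m\<in>{1..<n}. pot_coeff n k m * sc_deriv n m (1/2) w)"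

section \<open>Boundary behaviour of the potential in the disc\<close>

context
  fixes n :: nat
  assumes n2: "n \<ge> 2"
begin

text \<open>With s = 1/2 the phase rates of m and n - m are m - n/2 and its negative, and the normal
  raised to n is (-1)^l.\<close>

lemma arc_reflect:
  assumes \<phi>: "\<bar>\<phi>\<bar> < pi / (2 * real n)" and m: "m \<in> {1..<n}" and w: "w = out_normal n l * cis \<phi>"
  shows "w * sc_deriv n (n - m) (1/2) w = (-1) ^ l * cnj (w * sc_deriv n m (1/2) w)"
proof -
  define \<nu> where "\<nu> = out_normal n l"
  define h where "h = (2 * cos (real n * \<phi>)) powr - (1/2)"
  have "\<nu> ^ n = \<nu> ^ (n - m) * \<nu> ^ m" using m by (simp flip: power_add)
  moreover have "\<nu> ^ m * cnj (\<nu> ^ m) = 1" by (simp add: \<nu>_def flip: power_mult_distrib)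
  ultimately have "\<nu> ^ (n - m) = \<nu> ^ n * cnj (\<nu> ^ m)" by (simp add: mult.assoc)
  then have nu: "\<nu> ^ (n - m) = (-1) ^ l * cnj (\<nu> ^ m)" using out_normal_power(2)[OF n2] by (simp add: \<nu>_def)
  have e: "(real (n - m) - 1/2 * real n) * \<phi> = - ((real m - 1/2 * real n) * \<phi>)"
    using m by (simp add: of_nat_diff algebra_simps)
  have "w * sc_deriv n (n - m) (1/2) w = \<nu> ^ (n - m) * (complex_of_real h * cis (- ((real m - 1/2 * real n) * \<phi>)))"
    using arc_sc_deriv[OF n2 \<phi>, of "n - m" l "1/2"] m unfolding w \<nu>_def h_def e by simp
  moreover have "w * sc_deriv n m (1/2) w = \<nu> ^ m * (complex_of_real h * cis ((real m - 1/2 * real n) * \<phi>))"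
    using arc_sc_deriv[OF n2 \<phi>, of m l "1/2"] m unfolding w \<nu>_def h_def by simp
  ultimately show ?thesis by (simp add: nu cis_cnj mult.assoc)
qed

lemma half_bounds: "n > 0" "(0::real) < 1/2" "(1/2::real) \<le> 1/2"
  using n2 by auto

lemma sc_int_vertex:
  assumes "m > 0"
  shows "sc_int n m (1/2) (out_normal n l * cis (pi / (2 * real n)))
      = (out_normal n l * cis (pi / (2 * real n))) ^ m * complex_of_real (sc_radial n m (1/2) (-1))"
    "sc_int n m (1/2) (out_normal n l * cis (- (pi / (2 * real n))))
      = (out_normal n l * cis (- (pi / (2 * real n)))) ^ m * complex_of_real (sc_radial n m (1/2) (-1))"
  using vertex_power[OF n2, of l] half_bounds assms by (auto intro!: sc_int_ray)

lemma sc_radial_half_pos: "m > 0 \<Longrightarrow> sc_radial n m (1/2) (-1) > 0"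
  using half_bounds by (intro sc_radial_pos) auto

lemma complement_angle:
  assumes "m \<le> n"
  shows "real (n - m) * (pi / (2 * real n)) = pi / 2 - real m * (pi / (2 * real n))"
  using assms half_bounds by (simp add: of_nat_diff field_simps)

text \<open>The chord of \<open>sc_int n m\<close> over a side arc has length \<open>2 R\<^sub>m sin (\<pi> m / 2 n)\<close>, and the reflection
  \<open>m \<mapsto> n - m\<close> preserves it. This relates the ray integrals \<open>R\<^sub>m\<close> and \<open>R\<^bsub>n-m\<^esub>\<close> without evaluating
  them as Beta integrals.\<close>

lemma sc_radial_reflect:
  assumes m: "m \<in> {1..<n}"
  shows "sc_radial n m (1/2) (-1) * sin (real m * (pi / (2 * real n)))
    = sc_radial n (n - m) (1/2) (-1) * cos (real m * (pi / (2 * real n)))"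
proof -
  define a where "a = pi / (2 * real n)"
  define R where "R = sc_radial n m (1/2) (-1)"
  define R' where "R' = sc_radial n (n - m) (1/2) (-1)"
  \<comment> \<open>By \<open>arc_reflect\<close> the two derivatives cancel. Index 0 denotes side
    2n, the even side with normal 1, so no sign or rotation intervenes.\<close>
  define H where "H = (\<lambda>\<phi>. sc_int n (n - m) (1/2) (out_normal n 0 * cis \<phi>) + cnj (sc_int n m (1/2) (out_normal n 0 * cis \<phi>)))"
  have a: "a > 0" using half_angle[OF n2] by (simp add: a_def)
  have "H (-a) = H a"
  proof (rule equal_ends_if_derivative_zero)
    show "continuous_on {-a..a} H" unfolding H_def
      using half_bounds by (intro continuous_intros continuous_on_arc[OF n2] continuous_on_sc_int) auto
    fix \<phi> assume "\<phi> \<in> {-a<..<a}"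
    then have \<phi>: "\<bar>\<phi>\<bar> < pi / (2 * real n)" by (auto simp: a_def)
    define w where "w = out_normal n 0 * cis \<phi>"
    have d: "((\<lambda>\<phi>. sc_int n k (1/2) (out_normal n 0 * cis \<phi>)) has_vector_derivative \<i> * (w * sc_deriv n k (1/2) w)) (at \<phi>)" for k
      unfolding w_def using \<phi> half_bounds
      by (intro has_vector_derivative_along_arc has_field_derivative_sc_int arc_base(3)[OF n2]) auto
    have "(H has_vector_derivative \<i> * (w * sc_deriv n (n - m) (1/2) w) + cnj (\<i> * (w * sc_deriv n m (1/2) w))) (at \<phi>)"
      unfolding H_def by (intro has_vector_derivative_add has_vector_derivative_cnj d)
    moreover have "w * sc_deriv n (n - m) (1/2) w = cnj (w * sc_deriv n m (1/2) w)"
      using arc_reflect[OF \<phi> m w_def] by simp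
    ultimately show "(H has_vector_derivative 0) (at \<phi>)" by simp
  qed (use a in auto)
  then have "Im (H (-a)) = Im (H a)" by simp
  moreover have nu0: "out_normal n 0 = 1" by (simp add: out_normal_def)
  note vertex = sc_int_vertex[of _ 0, unfolded nu0 mult_1_left]
  ultimately have "R' * sin (real (n - m) * a) = R * sin (real m * a)"
    using m unfolding H_def a_def nu0 mult_1_left
    by (simp add: vertex Complex.DeMoivre R_def R'_def)
  then show ?thesis using complement_angle[of m] m unfolding R_def R'_def a_def
    by (simp add: sin_diff)
qed

text \<open>The real factor cos (m a) / R_m, with a = pi/(2n), is invariant under m to n - m by
  \<open>sc_radial_reflect\<close>, and the phase is conjugated because \<open>k\<close> is an
  integer.\<close>

lemma pot_coeff_reflect:
  assumes m: "m \<in> {1..<n}"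
  shows "pot_coeff n k (n - m) = cnj (pot_coeff n k m)"
proof -
  define a where "a = real m * (pi / (2 * real n))"
  define R where "R = sc_radial n m (1/2) (-1)"
  define R' where "R' = sc_radial n (n - m) (1/2) (-1)"
  have R: "R > 0" "R' > 0" using m by (auto simp: R_def R'_def intro: sc_radial_half_pos)
  have c: "cos (real (n - m) * (pi / (2 * real n))) = sin a"
    using complement_angle[of m] m by (simp add: a_def cos_diff)
  have "R * sin a = R' * cos a" using sc_radial_reflect[OF m] by (simp add: R_def R'_def a_def)
  then have quot: "2 * sin a / (real n * R') = 2 * cos a / (real n * R)"
    using R half_bounds by (simp add: field_simps)
  have "- (2 * pi * real (n - m) * real k / real n) = 2 * pi * real m * real k / real n + 2 * pi * real_of_int (- int k)"
    using m half_bounds by (simp add: of_nat_diff field_simps)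
  then have "cis (- (2 * pi * real (n - m) * real k / real n)) = cis (2 * pi * real m * real k / real n) * cis (2 * pi * real_of_int (- int k))"
    by (simp only: cis_mult)
  moreover have "cis (2 * pi * real_of_int (- int k)) = 1" by (rule cis_multiple_2pi) simp
  ultimately have "cis (- (2 * pi * real (n - m) * real k / real n)) = cis (2 * pi * real m * real k / real n)"
    by simp
  with quot show ?thesis
    unfolding pot_coeff_def c R_def[symmetric] R'_def[symmetric] a_def[symmetric] by (simp add: cis_cnj)
qed

text \<open>Pairing m with n - m shows that w times the derivative is real on even arcs and
  imaginary on odd ones. As i times this quantity is the tangential derivative and the quantity
  itself the radial one, these are the Dirichlet and Neumann conditions.\<close>

lemma pot_deriv_arc:
  assumes \<phi>: "\<bar>\<phi>\<bar> < pi / (2 * real n)" and w: "w = out_normal n l * cis \<phi>"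
  shows "w * pot_deriv n k w = (-1) ^ l * cnj (w * pot_deriv n k w)"
proof -
  have "w * pot_deriv n k w = (\<Sum>m\<in>{1..<n}. pot_coeff n k m * (w * sc_deriv n m (1/2) w))"
    unfolding pot_deriv_def sum_distrib_left by (intro sum.cong) auto
  also have "\<dots> = (\<Sum>m\<in>{1..<n}. pot_coeff n k (n - m) * (w * sc_deriv n (n - m) (1/2) w))"
    by (rule sum.reindex_bij_witness[of _ "\<lambda>m. n - m" "\<lambda>m. n - m"]) auto
  also have "\<dots> = (\<Sum>m\<in>{1..<n}. (-1) ^ l * cnj (w * (pot_coeff n k m * sc_deriv n m (1/2) w)))"
    by (intro sum.cong refl) (simp add: pot_coeff_reflect arc_reflect[OF \<phi> _ w] mult_ac)
  also have "\<dots> = (-1) ^ l * cnj (w * pot_deriv n k w)"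
    unfolding pot_deriv_def sum_distrib_left cnj_sum ..
  finally show ?thesis .
qed

lemma continuous_on_pot: "continuous_on (cball 0 1) (pot n k)"
  unfolding pot_def[abs_def] using half_bounds
  by (intro continuous_intros continuous_on_sc_int) auto

lemma has_field_derivative_pot:
  "w \<in> sc_dom n \<Longrightarrow> (pot n k has_field_derivative pot_deriv n k w) (at w)"
  unfolding pot_def[abs_def] pot_deriv_def using half_bounds
  by (intro DERIV_sum DERIV_cmult has_field_derivative_sc_int) auto

text \<open>The two ends of a node arc share the real part, which is the voltage up to a constant;
  their imaginary parts differ by the current.\<close>

lemma pot_vertex:
  assumes "j \<in> {1..n}" "k \<in> {1..n}"
  shows "pot n k (out_normal n (2*j) * cis (pi / (2 * real n))) = complex_of_real (((if j = k then real n else 0) - 1) / real n)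
          + \<i> * complex_of_real (cot (pi / real n * (real j - real k + 1/2)) / real n)" (is ?A)
    and "pot n k (out_normal n (2*j) * cis (- (pi / (2 * real n)))) = complex_of_real (((if j = k then real n else 0) - 1) / real n)
          + \<i> * complex_of_real (cot (pi / real n * (real j - real k - 1/2)) / real n)" (is ?B)
proof -
  define a where "a = pi / (2 * real n)"
  define x where "x = int j - int k"
  have x: "\<bar>x\<bar> < int n" using assms by (auto simp: x_def)
  \<comment> \<open>The sign \<open>\<sigma>\<close> selects the end of the arc; the odd integer 2 x
    + sigma is twice j - k +- 1/2.\<close>
  have *: "pot n k (out_normal n (2*j) * cis (real_of_int \<sigma> * a)) = complex_of_real (((if j = k then real n else 0) - 1) / real n)
          + \<i> * complex_of_real (cot (pi * real_of_int (2 * x + \<sigma>) / (2 * real n)) / real n)"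
    if \<sigma>: "\<sigma> = 1 \<or> \<sigma> = -1" for \<sigma>
  proof -
    have "pot_coeff n k m * sc_int n m (1/2) (out_normal n (2*j) * cis (real_of_int \<sigma> * a))
       = (cis (2 * pi * real m * real_of_int x / real n) + cis (pi * real m * real_of_int (2 * x + \<sigma>) / real n)) / of_nat n"
      if m: "m \<in> {1..<n}" for m
    proof -
      define R where "R = sc_radial n m (1/2) (-1)"
      have R: "R > 0" using m by (auto simp: R_def intro: sc_radial_half_pos)
      have coeff: "pot_coeff n k m = complex_of_real (2 * cos (real m * a) / (real n * R)) * cis (- (2 * pi * real m * real k / real n))"
        by (simp only: pot_coeff_def a_def R_def)
      have "sc_int n m (1/2) (out_normal n (2*j) * cis (real_of_int \<sigma> * a)) = (out_normal n (2*j) * cis (real_of_int \<sigma> * a)) ^ m * complex_of_real R"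
        using sc_int_vertex[of m "2*j"] \<sigma> m by (auto simp: a_def R_def)
      also have "\<dots> = cis (2 * pi * real m * real j / real n) * cis (real_of_int \<sigma> * (real m * a)) * complex_of_real R"
        by (simp add: power_mult_distrib out_normal_def Complex.DeMoivre mult_ac)
      finally have "pot_coeff n k m * sc_int n m (1/2) (out_normal n (2*j) * cis (real_of_int \<sigma> * a))
        = (cis (- (2 * pi * real m * real k / real n)) * cis (2 * pi * real m * real j / real n)) *
          (complex_of_real (2 * cos (real m * a)) * cis (real_of_int \<sigma> * (real m * a))) / of_nat n"
        unfolding coeff using R by (simp add: field_simps)
      also have "cis (- (2 * pi * real m * real k / real n)) * cis (2 * pi * real m * real j / real n)
          = cis (2 * pi * real m * real_of_int x / real n)"
        by (simp add: cis_mult x_def algebra_simps diff_divide_distrib)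
      also have "complex_of_real (2 * cos (real m * a)) * cis (real_of_int \<sigma> * (real m * a)) = 1 + cis (2 * (real_of_int \<sigma> * (real m * a)))"
        using \<sigma> by (subst one_plus_cis) auto
      also have "cis (2 * pi * real m * real_of_int x / real n) * (1 + cis (2 * (real_of_int \<sigma> * (real m * a))))
          = cis (2 * pi * real m * real_of_int x / real n) + cis (pi * real m * real_of_int (2 * x + \<sigma>) / real n)"
        using half_bounds by (simp add: distrib_left cis_mult a_def field_simps)
      finally show ?thesis .
    qed
    then have "pot n k (out_normal n (2*j) * cis (real_of_int \<sigma> * a))
       = (\<Sum>m\<in>{1..<n}. (cis (2 * pi * real m * real_of_int x / real n) + cis (pi * real m * real_of_int (2 * x + \<sigma>) / real n)) / of_nat n)"
      unfolding pot_def by (intro sum.cong) auto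
    also have "\<dots> = ((if x = 0 then of_nat n else 0) - 1 + \<i> * complex_of_real (cot (pi * real_of_int (2 * x + \<sigma>) / (2 * real n)))) / of_nat n"
      unfolding sum_divide_distrib[symmetric] sum.distrib
      using sum_cis_even[OF half_bounds(1) x] sum_cis_odd[OF half_bounds(1), of "2 * x + \<sigma>"] \<sigma> by auto
    also have "\<dots> = complex_of_real (((if j = k then real n else 0) - 1) / real n)
          + \<i> * complex_of_real (cot (pi * real_of_int (2 * x + \<sigma>) / (2 * real n)) / real n)"
      by (auto simp: x_def add_divide_distrib)
    finally show ?thesis .
  qed
  have "pi * real_of_int (2 * x + 1) / (2 * real n) = pi / real n * (real j - real k + 1/2)"
       "pi * real_of_int (2 * x + -1) / (2 * real n) = pi / real n * (real j - real k - 1/2)"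
    using half_bounds by (simp_all add: x_def field_simps)
  then show ?A ?B using *[of 1] *[of "-1"] by (simp_all only: a_def) auto
qed

lemma Re_pot_node_arc:
  assumes "\<bar>\<phi>\<bar> \<le> pi / (2 * real n)"
  shows "Re (pot n k (out_normal n (2*j) * cis \<phi>)) = Re (pot n k (out_normal n (2*j) * cis (- (pi / (2 * real n)))))"
proof (rule equal_ends_if_derivative_zero[symmetric, of "- (pi / (2 * real n))" \<phi> "\<lambda>\<phi>. Re (pot n k (out_normal n (2*j) * cis \<phi>))"])
  show "continuous_on {- (pi / (2 * real n))..\<phi>} (\<lambda>\<phi>. Re (pot n k (out_normal n (2 * j) * cis \<phi>)))"
    by (intro continuous_intros continuous_on_arc[OF n2] continuous_on_pot)
  fix u assume "u \<in> {- (pi / (2 * real n))<..<\<phi>}"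
  then have u: "\<bar>u\<bar> < pi / (2 * real n)" using assms by auto
  define w where "w = out_normal n (2*j) * cis u"
  have "((\<lambda>\<phi>. pot n k (out_normal n (2*j) * cis \<phi>)) has_vector_derivative \<i> * (w * pot_deriv n k w)) (at u)"
    unfolding w_def using u
    by (intro has_vector_derivative_along_arc has_field_derivative_pot arc_base(3)[OF n2])
  moreover have "Im (w * pot_deriv n k w) = 0"
    using arg_cong[OF pot_deriv_arc[OF u w_def, of k], of Im] by simp
  ultimately show "((\<lambda>\<phi>. Re (pot n k (out_normal n (2 * j) * cis \<phi>))) has_vector_derivative 0) (at u)"
    using has_real_derivative_Re by (fastforce simp: has_real_derivative_iff_has_vector_derivative)
qed (use assms in auto)

text \<open>Two solutions agree only on the polygon, as \<open>bvp\<close> is silent outside it. The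
  one-sided derivative samples just an inward segment, so agreement there suffices.\<close>

lemma outward_nd_cong:
  assumes "\<And>w. w \<in> polygon n \<Longrightarrow> V w = W w" "l \<in> {1..2*n}" "z \<in> open_segment (side_a n l) (side_b n l)"
    "outward_nd V (out_normal n l) z d"
  shows "outward_nd W (out_normal n l) z d"
proof -
  have z: "z \<in> closed_segment (side_a n l) (side_b n l)" using assms(3) by (simp add: open_segment_def)
  have eq: "V (z - complex_of_real t * out_normal n l) = W (z - complex_of_real t * out_normal n l)" if "0 \<le> t" "t \<le> 1" for t
    using assms(1) inward_normal_in_polygon[OF n2 assms(2) z that] by simp
  have "eventually (\<lambda>t. V (z - complex_of_real t * out_normal n l) = W (z - complex_of_real t * out_normal n l)) (at_right 0)"
    unfolding eventually_at_right[OF zero_less_one] using eq by (intro exI[of _ 1]) auto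
  then show ?thesis
    using assms(4) eq[of 0] unfolding outward_nd_def
    by (subst (asm) has_field_derivative_cong_eventually) auto
qed

lemma node_current_cong:
  assumes "\<And>w. w \<in> polygon n \<Longrightarrow> V w = W w" "j \<in> {1..n}" "node_current n V j I"
  shows "node_current n W j I"
proof -
  have "2 * j \<in> {1..2*n}" using assms(2) by auto
  from outward_nd_cong[OF assms(1) this] show ?thesis
    using assms(3) unfolding node_current_def Let_def by meson
qed

lemma solution_exists:
  assumes k: "k \<in> {1..n}"
  obtains V where "bvp n (\<lambda>m. if m = k then 1 else 0) V"
    "\<And>j. j \<in> {1..n} \<Longrightarrow> node_current n V j
       ((cot (pi / real n * (real j - real k + 1/2)) - cot (pi / real n * (real j - real k - 1/2))) / real n)"
proof -
  obtain g where g: "homeomorphism (cball 0 1) (polygon n) (sc_map n) g"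
    using sc_map_homeomorphism[OF n2] by blast
  have gf: "g (sc_map n w) = w" if "w \<in> cball 0 1" for w
    using g that by (auto simp: homeomorphism_def)
  have fg: "sc_map n (g z) = z" "g z \<in> cball 0 1" if "z \<in> polygon n" for z
    using g that by (auto simp: homeomorphism_def)
  have gc: "continuous_on (polygon n) g" using g by (simp add: homeomorphism_def)
  define \<Psi> where "\<Psi> = (\<lambda>z. pot n k (g z))"
  define D where "D = (\<lambda>z. pot_deriv n k (g z) / sc_map_deriv n (g z))"
  \<comment> \<open>The modes omit m = 0, so the real part on the nodes is the Kronecker delta minus
    1/n; the constant restores it.\<close>
  define V where "V = (\<lambda>z. Re (\<Psi> z) + 1 / real n)"
  have contPsi: "continuous_on (polygon n) \<Psi>"
    unfolding \<Psi>_def by (rule continuous_on_compose2[OF continuous_on_pot gc]) (use fg in auto)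
  \<comment> \<open>Valid inside and on the open sides alike, which is why the derivative is taken
    within the polygon; only vertices are excluded.\<close>
  have derPsi: "(\<Psi> has_field_derivative D z) (at z within polygon n)"
    if z: "z \<in> polygon n" "g z \<in> sc_dom n" for z
  proof -
    have "(g has_field_derivative 1 / sc_map_deriv n (g z)) (at z within polygon n)"
      using z fg gc by (intro has_field_derivative_inverse_within[OF has_field_derivative_sc_map[OF n2 z(2)]] sc_map_deriv_nonzero[OF n2])
        (auto simp: continuous_on_eq_continuous_within)
    from DERIV_chain2[OF has_field_derivative_pot[OF z(2)] this] show ?thesis
      unfolding \<Psi>_def D_def by simp
  qed
  have side: "\<exists>\<phi>. \<bar>\<phi>\<bar> \<le> pi / (2 * real n) \<and> g z = out_normal n l * cis \<phi>"
    if z: "z \<in> closed_segment (side_a n l) (side_b n l)" for z l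
  proof -
    obtain y where y: "y \<in> {- tan (pi / (2 * real n))..tan (pi / (2 * real n))}" "z = side_pt n l y"
      using z unfolding closed_side[OF n2] by blast
    then have "\<bar>y\<bar> \<le> tan (pi / (2 * real n))" by auto
    with y(2) obtain \<phi> where \<phi>: "\<bar>\<phi>\<bar> \<le> pi / (2 * real n)" "z = sc_map n (out_normal n l * cis \<phi>)"
      using sc_map_arc(2)[OF n2] by metis
    then have "g z = out_normal n l * cis \<phi>" using gf[OF arc_point_in_cball[OF n2]] by simp
    with \<phi>(1) show ?thesis by blast
  qed
  have ends: "g (side_a n l) = out_normal n l * cis (- (pi / (2 * real n)))"
      "g (side_b n l) = out_normal n l * cis (pi / (2 * real n))" for l
    using gf[OF arc_point_in_cball[OF n2]] sc_map_arc(3,4)[OF n2, of l] by metis+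
  have open_side: "\<exists>\<phi>. \<bar>\<phi>\<bar> < pi / (2 * real n) \<and> g z = out_normal n l * cis \<phi> \<and> g z \<in> sc_dom n"
    if l: "l \<in> {1..2*n}" and z: "z \<in> open_segment (side_a n l) (side_b n l)" for z l
  proof -
    have zc: "z \<in> closed_segment (side_a n l) (side_b n l)" "z \<noteq> side_a n l" "z \<noteq> side_b n l"
      using z by (auto simp: open_segment_def)
    then obtain \<phi> where \<phi>: "\<bar>\<phi>\<bar> \<le> pi / (2 * real n)" "g z = out_normal n l * cis \<phi>" using side by blast
    have zz: "z = sc_map n (out_normal n l * cis \<phi>)"
      using fg(1)[of z] \<phi>(2) closed_side_subset[OF n2 l] zc by auto
    have "\<phi> \<noteq> pi / (2 * real n)" "\<phi> \<noteq> - (pi / (2 * real n))"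
      using zc(2,3) sc_map_arc(3,4)[OF n2, of l] unfolding zz by auto
    then have "\<bar>\<phi>\<bar> < pi / (2 * real n)" using \<phi>(1) by auto
    then show ?thesis using \<phi>(2) arc_base(3)[OF n2] by auto
  qed
  have nd: "outward_nd V (out_normal n l) z (Re (out_normal n l * D z))"
    if l: "l \<in> {1..2*n}" and z: "z \<in> open_segment (side_a n l) (side_b n l)" for z l
  proof -
    have zc: "z \<in> closed_segment (side_a n l) (side_b n l)" using z by (simp add: open_segment_def)
    have zP: "z \<in> polygon n" "g z \<in> sc_dom n" using zc closed_side_subset[OF n2 l] open_side[OF l z] by auto
    then have "(\<Psi> has_field_derivative D z) (at (z + - out_normal n l * complex_of_real 0) within polygon n)"
      using derPsi by simp
    then have "((\<lambda>s. \<Psi> (z + - out_normal n l * complex_of_real s)) has_vector_derivative - out_normal n l * D z) (at 0 within {0..1})"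
      by (rule has_vector_derivative_along_line)
         (use inward_normal_in_polygon[OF n2 l zc] in \<open>simp add: mult.commute\<close>)
    then have "((\<lambda>s. \<Psi> (z - complex_of_real s * out_normal n l)) has_vector_derivative - out_normal n l * D z) (at_right 0)"
      by (simp add: at_within_Icc_at_right mult.commute)
    from DERIV_add[OF has_real_derivative_Re[OF this] DERIV_const[of "1 / real n"]]
    show ?thesis unfolding outward_nd_def V_def by simp
  qed
  have "bvp n (\<lambda>m. if m = k then 1 else 0) V"
    unfolding bvp_def
  proof (intro conjI ballI)
    show "continuous_on (polygon n) V" unfolding V_def by (intro continuous_intros contPsi)
    have "(\<Psi> has_field_derivative D z) (at z)" if z: "z \<in> interior (polygon n)" for z
    proof -
      obtain w where "w \<in> ball 0 1" "z = sc_map n w" using z sc_map_image_ball[OF n2] by blast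
      then have "g z \<in> ball 0 1" using gf[of w] by auto
      then have "g z \<in> sc_dom n" using ball_subset_sc_dom[OF half_bounds(1)] by blast
      then show ?thesis using derPsi[of z] z interior_subset at_within_interior[OF z] by fastforce
    qed
    then have "\<Psi> holomorphic_on interior (polygon n)" by (auto simp: holomorphic_on_open)
    then show "harmonic_on (interior (polygon n)) V"
      unfolding V_def by (intro harmonic_on_Re) auto
  next
    fix j z assume j: "j \<in> {1..n}" and z: "z \<in> closed_segment (side_a n (2 * j)) (side_b n (2 * j))"
    obtain \<phi> where "\<bar>\<phi>\<bar> \<le> pi / (2 * real n)" "g z = out_normal n (2*j) * cis \<phi>" using side[OF z] by blast
    then have "Re (\<Psi> z) = ((if j = k then real n else 0) - 1) / real n"
      unfolding \<Psi>_def by (simp add: Re_pot_node_arc pot_vertex[OF j k])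
    then show "V z = (if j = k then 1 else 0)" using half_bounds by (simp add: V_def field_simps)
  next
    fix j z assume j: "j \<in> {1..n}" and z: "z \<in> open_segment (side_a n (2 * j - 1)) (side_b n (2 * j - 1))"
    define l where "l = 2 * j - 1"
    have l: "l \<in> {1..2*n}" "odd l" using j by (auto simp: l_def)
    obtain \<phi> where \<phi>: "\<bar>\<phi>\<bar> < pi / (2 * real n)" "g z = out_normal n l * cis \<phi>"
      using open_side[OF l(1)] z unfolding l_def by blast
    define w where "w = g z"
    have w: "w = out_normal n l * cis \<phi>" using \<phi> by (simp add: w_def)
    obtain \<rho> where \<rho>: "\<rho> > 0" "w * sc_map_deriv n w = out_normal n l * complex_of_real \<rho>"
      using arc_sc_map_deriv[OF n2 \<phi>(1), of l] unfolding w by blast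
    have "w \<in> sc_dom n" unfolding w by (rule arc_base(3)[OF n2 \<phi>(1)])
    then have "sc_map_deriv n w \<noteq> 0" by (rule sc_map_deriv_nonzero[OF n2])
    \<comment> \<open>The conformal map turns the radial direction into a positive multiple of the
      normal, so the normal derivative is a positive multiple of the radial one in the disc.\<close>
    then have "out_normal n l * D z = w * pot_deriv n k w / complex_of_real \<rho>"
      using \<rho> by (simp add: D_def w_def[symmetric] field_simps)
    moreover have "Re (w * pot_deriv n k w) = 0"
      using arg_cong[OF pot_deriv_arc[OF \<phi>(1) w, of k], of Re] l(2) by simp
    ultimately have "Re (out_normal n l * D z) = 0" by (simp only: Re_divide_of_real div_0)
    then show "outward_nd V (out_normal n (2 * j - 1)) z 0"
      using nd[OF l(1), of z] z unfolding l_def by simp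
  qed
  moreover have "node_current n V j
       ((cot (pi / real n * (real j - real k + 1/2)) - cot (pi / real n * (real j - real k - 1/2))) / real n)"
    if j: "j \<in> {1..n}" for j
  proof -
    define a where "a = side_a n (2*j)"
    define b where "b = side_b n (2*j)"
    define \<nu> where "\<nu> = out_normal n (2*j)"
    have l: "2 * j \<in> {1..2*n}" using j by auto
    have ba: "b - a = \<nu> * (\<i> * complex_of_real (norm (b - a)))"
    proof -
      have "b - a = \<nu> * (\<i> * complex_of_real (2 * tan (pi / (2 * real n))))"
        unfolding a_def b_def \<nu>_def side_ends[OF n2] side_pt_diff[OF n2] by simp
      moreover from this have "norm (b - a) = 2 * tan (pi / (2 * real n))"
        using tan_half_angle[OF n2] by (simp add: norm_mult \<nu>_def)
      ultimately show ?thesis by simp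
    qed
    have lp: "linepath a b s = a + (b - a) * complex_of_real s" for s
      by (simp add: linepath_def scaleR_conv_of_real algebra_simps)
    have inP: "a + (b - a) * complex_of_real s \<in> polygon n" if "s \<in> {0..1}" for s
    proof -
      have "linepath a b s \<in> closed_segment a b" by (rule linepath_in_path[OF that])
      then have "linepath a b s \<in> polygon n"
        unfolding a_def b_def by (rule subsetD[OF closed_side_subset[OF n2 l]])
      then show ?thesis by (simp only: lp)
    qed
    \<comment> \<open>Cauchy-Riemann: the side direction is i times the normal, so the normal
      derivative of Re Psi is the tangential derivative of Im Psi. Continuity of Im Psi at the two
      vertices handles the possibly improper integral.\<close>
    have "((\<lambda>s. norm (b - a) * Re (\<nu> * D (linepath a b s))) has_integral
        (Im (\<Psi> (a + (b - a) * complex_of_real 1)) - Im (\<Psi> (a + (b - a) * complex_of_real 0)))) {0..1}"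
    proof (rule fundamental_theorem_of_calculus_interior)
      show "continuous_on {0..1} (\<lambda>s. Im (\<Psi> (a + (b - a) * complex_of_real s)))"
        by (intro continuous_intros continuous_on_compose2[OF contPsi]) (use inP in \<open>auto intro!: continuous_intros\<close>)
      fix s :: real assume s: "s \<in> {0<..<1}"
      define z where "z = a + (b - a) * complex_of_real s"
      have "a \<noteq> b" using tan_half_angle(1)[OF n2] by (simp add: a_def b_def side_ends[OF n2] side_pt_inj[OF n2])
      then have z: "z \<in> open_segment a b"
        unfolding z_def lp[symmetric] using s by (auto simp: in_segment linepath_def)
      have "(\<Psi> has_field_derivative D z) (at (a + (b - a) * complex_of_real s) within polygon n)"
        using derPsi[of z] inP[of s] s open_side[OF l, of z] z unfolding z_def a_def b_def by auto
      then have "((\<lambda>s. \<Psi> (a + (b - a) * complex_of_real s)) has_vector_derivative (b - a) * D z) (at s within {0..1})"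
        by (rule has_vector_derivative_along_line) (rule inP)
      moreover have "at s within {0..1} = at s" using s by (intro at_within_interior) auto
      ultimately have "((\<lambda>s. Im (\<Psi> (a + (b - a) * complex_of_real s))) has_real_derivative Im ((b - a) * D z)) (at s)"
        using has_real_derivative_Im by metis
      moreover have "Im ((b - a) * D z) = norm (b - a) * Re (\<nu> * D z)"
      proof -
        have "(b - a) * D z = \<i> * (norm (b - a) *\<^sub>R (\<nu> * D z))"
          by (subst ba) (simp add: scaleR_conv_of_real mult_ac)
        then show ?thesis by (simp only: Im_i_times scaleR_complex.sel)
      qed
      ultimately show "((\<lambda>s. Im (\<Psi> (a + (b - a) * complex_of_real s))) has_vector_derivative
          norm (b - a) * Re (\<nu> * D (linepath a b s))) (at s)"
        by (simp add: has_real_derivative_iff_has_vector_derivative lp z_def)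
    qed simp
    moreover have "Im (\<Psi> b) - Im (\<Psi> a) = (cot (pi / real n * (real j - real k + 1/2)) - cot (pi / real n * (real j - real k - 1/2))) / real n"
      unfolding \<Psi>_def a_def b_def ends pot_vertex[OF j k] by (simp add: diff_divide_distrib)
    ultimately have "((\<lambda>s. norm (b - a) * Re (\<nu> * D (linepath a b s))) has_integral
        ((cot (pi / real n * (real j - real k + 1/2)) - cot (pi / real n * (real j - real k - 1/2))) / real n)) {0..1}"
      by simp
    then show ?thesis
      unfolding node_current_def Let_def a_def b_def \<nu>_def
      using nd[OF l] by (intro exI[of _ "\<lambda>z. Re (out_normal n (2*j) * D z)"]) auto
  qed
  ultimately show ?thesis using that by blast
qed

end

text \<open>Existence is asserted next to the universal claim so that the latter is not vacuous;
  uniqueness transfers the explicit current to every solution.\<close>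

theorem theorem1:
  fixes n j k :: nat
  assumes "n \<ge> 2" and "j \<in> {1..n}" and "k \<in> {1..n}"
  shows "(\<exists>V. bvp n (\<lambda>m. if m = k then 1 else 0) V) \<and>
         (\<forall>V. bvp n (\<lambda>m. if m = k then 1 else 0) V \<longrightarrow>
            node_current n V j
              ((cot (pi / real n * (real j - real k + 1/2))
                - cot (pi / real n * (real j - real k - 1/2))) / real n))"
proof -
  obtain V where V: "bvp n (\<lambda>m. if m = k then 1 else 0) V"
    and I: "node_current n V j ((cot (pi / real n * (real j - real k + 1/2))
                - cot (pi / real n * (real j - real k - 1/2))) / real n)"
    using solution_exists[OF assms(1,3)] assms(2) by blast
  then show ?thesis
    using node_current_cong[OF assms(1) _ assms(2) I] bvp_unique[OF assms(1) V] by blast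
qed

end
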